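(* Let $k$ be a field of characteristic zero, let $D=k[d_1,\dots,d_n]$, let $M$ be a finitely generated $n$-pure $D$-module (so that $\dim_k(M)<\infty$), and let $M^*=\hom_k(M,k)$. Let $\mathfrak m\in \mathrm{ass}(M)$, let $N$ be defined by the short exact sequence $0\to \mathrm{soc}_{\mathfrak m}(M)\to M\to N\to 0$, and consider the dual short exact sequence $$0\longrightarrow N^*\longrightarrow M^*\longrightarrow \mathrm{top}_{\mathfrak m}(M^* )\longrightarrow 0 .$$ Then $N^*\simeq \mathfrak m M^*$, and this short exact sequence is isomorphic to the short exact sequence $$0\longrightarrow \mathfrak m M^*\longrightarrow M^*\longrightarrow D/\mathfrak m\otimes_D M^*\longrightarrow 0 .$$
   Context: $D=k[d_1,\dots,d_n]$ is the commutative polynomial ring in $n$ commuting formal derivatives over the field of constants $k$. A nonzero finitely generated $D$-module $M$ is $n$-pure if $cd_D(Dm)=n$ for all $0\ne m\in M$, where $cd_D(N)=n-d(N)$ and $d(N)$ is the Krull dimension of $D/\mathrm{ann}_D(N)$; this is equivalent to $\dim_k(M)<\infty$, and then $\mathrm{ass}(M)\subset \max(D)$, where $\mathrm{ass}(M)$ is the set of associated primes of $M$ and $\max(D)$ the set of maximal ideals. For a $D$-module $X$, $X^*=\hom_k(X,k)$ is a $D$-module through $(d_if)(x)=f(d_ix)$ (the paper's sign convention for constant coefficients), and duals of exact sequences are taken with $\hom_k(-,k)$. For $\mathfrak m\in\mathrm{ass}(M)$, $\mathrm{soc}_{\mathfrak m}(M)$ (the socle of $M$ at $\mathfrak m$)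 is the sum of all simple submodules of $M$ isomorphic to $D/\mathfrak m$, i.e. the submodule of elements of $M$ killed by $\mathfrak m$; it is a direct sum of copies of $D/\mathfrak m$. $\mathrm{top}_{\mathfrak m}(M^* )$ denotes the cokernel of $N^*\to M^*$, i.e. the dual of $\mathrm{soc}_{\mathfrak m}(M)$. *)

theory Defs
  imports
    "HOL-Algebra.Algebra"
    "HOL-Algebra.Algebraic_Closure_Type"
    "HOL-Library.Poly_Mapping"
    "HOL-Library.Extended_Real"
begin

section \<open>Modules over a commutative ring\<close>

definition mod_hom ::
    "('r, 'x) ring_scheme \<Rightarrow> ('r, 'a, 'y) module_scheme \<Rightarrow> ('r, 'b, 'z) module_scheme \<Rightarrow> ('a \<Rightarrow> 'b) set"
  where "mod_hom R M N = {h \<in> carrier M \<rightarrow> carrier N.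
    (\<forall>x\<in>carrier M. \<forall>y\<in>carrier M. h (x \<oplus>\<^bsub>M\<^esub> y) = h x \<oplus>\<^bsub>N\<^esub> h y) \<and>
    (\<forall>a\<in>carrier R. \<forall>x\<in>carrier M. h (a \<odot>\<^bsub>M\<^esub> x) = a \<odot>\<^bsub>N\<^esub> h x)}"

definition mod_iso ::
    "('r, 'x) ring_scheme \<Rightarrow> ('r, 'a, 'y) module_scheme \<Rightarrow> ('r, 'b, 'z) module_scheme \<Rightarrow> ('a \<Rightarrow> 'b) set"
  where "mod_iso R M N = {h \<in> mod_hom R M N. bij_betw h (carrier M) (carrier N)}"

definition short_exact ::
    "('r, 'x) ring_scheme \<Rightarrow> ('r, 'a, 'u) module_scheme \<Rightarrow> ('a \<Rightarrow> 'b) \<Rightarrow> ('r, 'b, 'v) module_scheme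
      \<Rightarrow> ('b \<Rightarrow> 'c) \<Rightarrow> ('r, 'c, 'w) module_scheme \<Rightarrow> bool"
  where "short_exact R A f B g C \<longleftrightarrow>
    module R A \<and> module R B \<and> module R C \<and>
    f \<in> mod_hom R A B \<and> g \<in> mod_hom R B C \<and>
    inj_on f (carrier A) \<and>
    f ` carrier A = {y \<in> carrier B. g y = \<zero>\<^bsub>C\<^esub>} \<and>
    g ` carrier B = carrier C"

definition sequences_isomorphic ::
    "('r, 'x) ring_scheme
      \<Rightarrow> ('r, 'a, 'u) module_scheme \<Rightarrow> ('a \<Rightarrow> 'b) \<Rightarrow> ('r, 'b, 'v) module_scheme
      \<Rightarrow> ('b \<Rightarrow> 'c) \<Rightarrow> ('r, 'c, 'w) module_scheme
      \<Rightarrow> ('r, 'd, 'u2) module_scheme \<Rightarrow> ('d \<Rightarrow> 'e) \<Rightarrow> ('r, 'e, 'v2) module_scheme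
      \<Rightarrow> ('e \<Rightarrow> 'f) \<Rightarrow> ('r, 'f, 'w2) module_scheme \<Rightarrow> bool"
  where "sequences_isomorphic R A f B g C A' f' B' g' C' \<longleftrightarrow>
    (\<exists>\<alpha>\<in>mod_iso R A A'. \<exists>\<beta>\<in>mod_iso R B B'. \<exists>\<gamma>\<in>mod_iso R C C'.
      (\<forall>x\<in>carrier A. \<beta> (f x) = f' (\<alpha> x)) \<and>
      (\<forall>y\<in>carrier B. \<gamma> (g y) = g' (\<beta> y)))"

definition mod_span ::
    "('r, 'x) ring_scheme \<Rightarrow> ('r, 'a, 'y) module_scheme \<Rightarrow> 'a set \<Rightarrow> 'a set"
  where "mod_span R M S = \<Inter>{H. submodule H R M \<and> S \<subseteq> H}"

definition finitely_generated :: "('r, 'x) ring_scheme \<Rightarrow> ('r, 'a, 'y) module_scheme \<Rightarrow> bool"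
  where "finitely_generated R M \<longleftrightarrow>
    (\<exists>S. finite S \<and> S \<subseteq> carrier M \<and> mod_span R M S = carrier M)"

definition simple_module :: "('r, 'x) ring_scheme \<Rightarrow> ('r, 'a, 'y) module_scheme \<Rightarrow> bool"
  where "simple_module R M \<longleftrightarrow> module R M \<and> carrier M \<noteq> {\<zero>\<^bsub>M\<^esub>} \<and>
    (\<forall>H. submodule H R M \<longrightarrow> H = {\<zero>\<^bsub>M\<^esub>} \<or> H = carrier M)"

definition annihilator :: "('r, 'x) ring_scheme \<Rightarrow> ('r, 'a, 'y) module_scheme \<Rightarrow> 'r set"
  where "annihilator R M = {a \<in> carrier R. \<forall>x\<in>carrier M. a \<odot>\<^bsub>M\<^esub> x = \<zero>\<^bsub>M\<^esub>}"

definition associated_primes :: "('r, 'x) ring_scheme \<Rightarrow> ('r, 'a, 'y) module_scheme \<Rightarrow> 'r set set"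
  where "associated_primes R M = {P. primeideal P R \<and>
    (\<exists>x\<in>carrier M. P = {a \<in> carrier R. a \<odot>\<^bsub>M\<^esub> x = \<zero>\<^bsub>M\<^esub>})}"

definition cyclic_submodule ::
    "('r, 'x) ring_scheme \<Rightarrow> ('r, 'a, 'y) module_scheme \<Rightarrow> 'a \<Rightarrow> ('r, 'a, 'y) module_scheme"
  where "cyclic_submodule R M x = M\<lparr>carrier := (\<lambda>a. a \<odot>\<^bsub>M\<^esub> x) ` carrier R\<rparr>"

text \<open>
  A record of type \<open>module\<close> extends the record of rings; the fields \<open>mult\<close> and \<open>one\<close> play no role
  for modules and are left undefined below.
\<close>

definition ring_as_module :: "('r, 'x) ring_scheme \<Rightarrow> ('r, 'r) module"
  where "ring_as_module R = \<lparr>carrier = carrier R, monoid.mult = undefined, one = undefined,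
    ring.zero = \<zero>\<^bsub>R\<^esub>, add = add R, module.smult = monoid.mult R\<rparr>"

definition quot_module :: "('r, 'a, 'y) module_scheme \<Rightarrow> 'a set \<Rightarrow> ('r, 'a set) module"
  where "quot_module M H = \<lparr>carrier = a_rcosets\<^bsub>M\<^esub> H, monoid.mult = undefined, one = undefined,
    ring.zero = H, add = set_add M, module.smult = (\<lambda>a C. \<Union>x\<in>C. H +>\<^bsub>M\<^esub> (a \<odot>\<^bsub>M\<^esub> x))\<rparr>"

definition ideal_mult_module ::
    "('r, 'x) ring_scheme \<Rightarrow> 'r set \<Rightarrow> ('r, 'a, 'y) module_scheme \<Rightarrow> ('r, 'a, 'y) module_scheme"
  where "ideal_mult_module R I M =
    M\<lparr>carrier := mod_span R M {a \<odot>\<^bsub>M\<^esub> x | a x. a \<in> I \<and> x \<in> carrier M}\<rparr>"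

text \<open>The sum of a family of submodules is the submodule generated by their union.\<close>

definition socle_at ::
    "('r, 'x) ring_scheme \<Rightarrow> 'r set \<Rightarrow> ('r, 'a, 'y) module_scheme \<Rightarrow> ('r, 'a, 'y) module_scheme"
  where "socle_at R \<mm> M = M\<lparr>carrier := mod_span R M (\<Union>{S. submodule S R M \<and>
    simple_module R (M\<lparr>carrier := S\<rparr>) \<and>
    mod_iso R (M\<lparr>carrier := S\<rparr>) (quot_module (ring_as_module R) \<mm>) \<noteq> {}})\<rparr>"


section \<open>Tensor products\<close>

definition free_module :: "('r, 'x) ring_scheme \<Rightarrow> 'i set \<Rightarrow> ('r, 'i \<Rightarrow> 'r) module"
  where "free_module R I = \<lparr>
    carrier = {f. (\<forall>i\<in>I. f i \<in> carrier R) \<and> (\<forall>i. i \<notin> I \<longrightarrow> f i = \<zero>\<^bsub>R\<^esub>) \<and>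
                  finite {i. f i \<noteq> \<zero>\<^bsub>R\<^esub>}},
    monoid.mult = undefined, one = undefined,
    ring.zero = (\<lambda>_. \<zero>\<^bsub>R\<^esub>), add = (\<lambda>f g i. f i \<oplus>\<^bsub>R\<^esub> g i), module.smult = (\<lambda>a f i. a \<otimes>\<^bsub>R\<^esub> f i)\<rparr>"

definition free_gen :: "('r, 'x) ring_scheme \<Rightarrow> 'i \<Rightarrow> 'i \<Rightarrow> 'r"
  where "free_gen R i = (\<lambda>j. if j = i then \<one>\<^bsub>R\<^esub> else \<zero>\<^bsub>R\<^esub>)"

definition tensor_relations ::
    "('r, 'x) ring_scheme \<Rightarrow> ('r, 'a, 'y) module_scheme \<Rightarrow> ('r, 'b, 'z) module_scheme
      \<Rightarrow> ('a \<times> 'b \<Rightarrow> 'r) set"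
  where "tensor_relations R A B = (let F = free_module R (carrier A \<times> carrier B); \<delta> = free_gen R in
    {\<delta> (a \<oplus>\<^bsub>A\<^esub> a', b) \<ominus>\<^bsub>F\<^esub> (\<delta> (a, b) \<oplus>\<^bsub>F\<^esub> \<delta> (a', b)) | a a' b.
        a \<in> carrier A \<and> a' \<in> carrier A \<and> b \<in> carrier B} \<union>
    {\<delta> (a, b \<oplus>\<^bsub>B\<^esub> b') \<ominus>\<^bsub>F\<^esub> (\<delta> (a, b) \<oplus>\<^bsub>F\<^esub> \<delta> (a, b')) | a b b'.
        a \<in> carrier A \<and> b \<in> carrier B \<and> b' \<in> carrier B} \<union>
    {\<delta> (r \<odot>\<^bsub>A\<^esub> a, b) \<ominus>\<^bsub>F\<^esub> (r \<odot>\<^bsub>F\<^esub> \<delta> (a, b)) | r a b.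
        r \<in> carrier R \<and> a \<in> carrier A \<and> b \<in> carrier B} \<union>
    {\<delta> (a, r \<odot>\<^bsub>B\<^esub> b) \<ominus>\<^bsub>F\<^esub> (r \<odot>\<^bsub>F\<^esub> \<delta> (a, b)) | r a b.
        r \<in> carrier R \<and> a \<in> carrier A \<and> b \<in> carrier B})"

definition tensor_kernel ::
    "('r, 'x) ring_scheme \<Rightarrow> ('r, 'a, 'y) module_scheme \<Rightarrow> ('r, 'b, 'z) module_scheme
      \<Rightarrow> ('a \<times> 'b \<Rightarrow> 'r) set"
  where "tensor_kernel R A B =
    mod_span R (free_module R (carrier A \<times> carrier B)) (tensor_relations R A B)"

definition tensor_module ::
    "('r, 'x) ring_scheme \<Rightarrow> ('r, 'a, 'y) module_scheme \<Rightarrow> ('r, 'b, 'z) module_scheme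
      \<Rightarrow> ('r, ('a \<times> 'b \<Rightarrow> 'r) set) module"
  where "tensor_module R A B =
    quot_module (free_module R (carrier A \<times> carrier B)) (tensor_kernel R A B)"

definition pure_tensor ::
    "('r, 'x) ring_scheme \<Rightarrow> ('r, 'a, 'y) module_scheme \<Rightarrow> ('r, 'b, 'z) module_scheme
      \<Rightarrow> 'a \<Rightarrow> 'b \<Rightarrow> ('a \<times> 'b \<Rightarrow> 'r) set"
  where "pure_tensor R A B a b =
    tensor_kernel R A B +>\<^bsub>free_module R (carrier A \<times> carrier B)\<^esub> free_gen R (a, b)"


section \<open>Krull dimension\<close>

text \<open>With values in \<^typ>\<open>ereal\<close> the zero ring has dimension \<open>-\<infinity>\<close> and no subtraction is truncated.\<close>

definition krull_dim :: "('r, 'x) ring_scheme \<Rightarrow> ereal"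
  where "krull_dim R = Sup {ereal (real r) | r. \<exists>P :: nat \<Rightarrow> 'r set.
    (\<forall>i\<le>r. primeideal (P i) R) \<and> (\<forall>i<r. P i \<subset> P (Suc i))}"

definition module_dim :: "('r, 'x) ring_scheme \<Rightarrow> ('r, 'a, 'y) module_scheme \<Rightarrow> ereal"
  where "module_dim R M = krull_dim (R Quot annihilator R M)"


section \<open>The ring of differential operators with constant coefficients\<close>

type_synonym 'k mpoly = "(nat \<Rightarrow>\<^sub>0 nat) \<Rightarrow>\<^sub>0 'k"

text \<open>The polynomial ring over \<open>'k\<close> in the indeterminates \<open>d\<^sub>1, \<dots>, d\<^sub>n\<close>, indexed by \<open>{1..n}\<close>.\<close>

definition diff_ring :: "nat \<Rightarrow> 'k::field mpoly ring"
  where "diff_ring n = ring_of_type_algebra\<lparr>carrier := {p. \<forall>m\<in>Poly_Mapping.keys p. Poly_Mapping.keys m \<subseteq> {1..n}}\<rparr>"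

abbreviation const_poly :: "'k::field \<Rightarrow> 'k mpoly"
  where "const_poly c \<equiv> Poly_Mapping.single 0 c"

definition cd :: "nat \<Rightarrow> ('k::field mpoly, 'a, 'y) module_scheme \<Rightarrow> ereal"
  where "cd n M = ereal (real n) - module_dim (diff_ring n) M"

definition n_pure :: "nat \<Rightarrow> ('k::field mpoly, 'a, 'y) module_scheme \<Rightarrow> bool"
  where "n_pure n M \<longleftrightarrow> module (diff_ring n) M \<and> finitely_generated (diff_ring n) M \<and>
    carrier M \<noteq> {\<zero>\<^bsub>M\<^esub>} \<and>
    (\<forall>x\<in>carrier M. x \<noteq> \<zero>\<^bsub>M\<^esub> \<longrightarrow> cd n (cyclic_submodule (diff_ring n) M x) = ereal (real n))"

text \<open>
  Functionals are \<^const>\<open>extensional\<close>, so that they are determined by their values on the carrier.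
  The rule \<open>(d\<^sub>i f) x = f (d\<^sub>i x)\<close>, extended along products and \<open>k\<close>-linear combinations of
  the commuting \<open>d\<^sub>i\<close>, reads \<open>(p f) x = f (p x)\<close>.
\<close>

definition dual :: "('k::field mpoly, 'a, 'y) module_scheme \<Rightarrow> ('k mpoly, 'a \<Rightarrow> 'k) module"
  where "dual M = \<lparr>
    carrier = {f \<in> extensional (carrier M).
      (\<forall>x\<in>carrier M. \<forall>y\<in>carrier M. f (x \<oplus>\<^bsub>M\<^esub> y) = f x + f y) \<and>
      (\<forall>c. \<forall>x\<in>carrier M. f (const_poly c \<odot>\<^bsub>M\<^esub> x) = c * f x)},
    monoid.mult = undefined, one = undefined,
    ring.zero = (\<lambda>x\<in>carrier M. 0),
    add = (\<lambda>f g. \<lambda>x\<in>carrier M. f x + g x),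
    module.smult = (\<lambda>p f. \<lambda>x\<in>carrier M. f (p \<odot>\<^bsub>M\<^esub> x))\<rparr>"

text \<open>The dual of a homomorphism \<open>h\<close> with domain \<open>M\<close>.\<close>

definition dual_map :: "('r, 'a, 'y) module_scheme \<Rightarrow> ('a \<Rightarrow> 'b) \<Rightarrow> ('b \<Rightarrow> 'k) \<Rightarrow> 'a \<Rightarrow> 'k"
  where "dual_map M h f = (\<lambda>x\<in>carrier M. f (h x))"

text \<open>
  \<open>top_at n \<mm> M\<close> is \<open>top\<^sub>\<mm> (M\<^sup>*)\<close>. Exactness of the dual sequence identifies it with the
  cokernel of \<open>N\<^sup>* \<rightarrow> M\<^sup>*\<close>.
\<close>

definition top_at ::
    "nat \<Rightarrow> 'k::field mpoly set \<Rightarrow> ('k mpoly, 'a, 'y) module_scheme \<Rightarrow> ('k mpoly, 'a \<Rightarrow> 'k) module"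
  where "top_at n \<mm> M = dual (socle_at (diff_ring n) \<mm> M)"

abbreviation residue_module :: "nat \<Rightarrow> 'k::field mpoly set \<Rightarrow> ('k mpoly, 'k mpoly set) module"
  where "residue_module n \<mm> \<equiv> quot_module (ring_as_module (diff_ring n)) \<mm>"

text \<open>The map \<open>Y \<rightarrow> D/\<mm> \<otimes>\<^sub>D Y\<close>, \<open>x \<mapsto> 1 \<otimes> x\<close>.\<close>

definition residue_tensor_map ::
    "nat \<Rightarrow> 'k::field mpoly set \<Rightarrow> ('k mpoly, 'a, 'y) module_scheme
      \<Rightarrow> 'a \<Rightarrow> ('k mpoly set \<times> 'a \<Rightarrow> 'k mpoly) set"
  where "residue_tensor_map n \<mm> Y x =
    pure_tensor (diff_ring n) (residue_module n \<mm>) Y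
      (\<mm> +>\<^bsub>ring_as_module (diff_ring n)\<^esub> \<one>\<^bsub>diff_ring n\<^esub>) x"

end

theory Submission
  imports Defs
begin

text \<open>
  Purity makes \<open>D/\<mm>\<close> a domain of Krull dimension zero, so \<open>\<mm>\<close> is maximal and the socle at
  \<open>\<mm>\<close> is the set of elements killed by \<open>\<mm>\<close>. Extending \<open>k\<close>-linear functionals from subspaces
  makes the dual sequence exact, and identifies \<open>N\<^sup>*\<close> with the functionals on \<open>M\<close>
  vanishing on the socle. These are exactly the elements of \<open>\<mm> M\<^sup>*\<close>: by Hilbert's basis theorem
  \<open>\<mm>\<close> is generated by some \<open>a\<^sub>1, \<dots>, a\<^sub>r\<close>, and a functional vanishing on the common kernel
  of the \<open>a\<^sub>i\<close> has the form \<open>\<Sum>i. a\<^sub>i g\<^sub>i\<close>. Since \<open>\<mm> Y\<close> is the kernel of \<open>Y \<rightarrow> D/\<mm> \<otimes> Y\<close> for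
  every module \<open>Y\<close>, both sequences have the same middle term and the same kernel.
\<close>

section \<open>Homomorphisms, submodules and quotients\<close>

text \<open>The hard inclusion is that a functional f vanishing on the socle lies in
  \<open>\<mm> M\<^sup>*\<close>; the other one is the computation (a g)(x) = g(a x) = 0. If a_1,
  ..., a_r generate \<open>\<mm>\<close>, the socle is the kernel of the map x |-> (a_1 x, ..., a_r
  x) from M to M^r. Hence f factors through the image of this map, the factor extends to a
  functional on M^r, and such a functional is a tuple (g_1, ..., g_r), which gives f = a_1 g_1 + ...
  + a_r g_r. The formal argument treats one generator at a time; this avoids powers of M and rests
  on the finiteness of the generating set. Maximality of \<open>\<mm>\<close> enters through the
  socle, which is defined by simple submodules: D/\<mm> has to be simple for the nonzero elements
  killed by \<open>\<mm>\<close> to span such submodules. The two sequences are compared through the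
  images of their injections: \<open>\<mm> M\<^sup>*\<close> is a subset of
  \<open>M\<^sup>*\<close>, whereas the dual of N consists of functionals on another carrier and is
  first pulled back along \<open>\<pi>\<close>.\<close>

lemma (in abelian_group) minus_eq_zero_iff:
  "x \<in> carrier G \<Longrightarrow> y \<in> carrier G \<Longrightarrow> x \<ominus> y = \<zero> \<longleftrightarrow> x = y"
  by (metis a_minus_def add.inv_closed add.inv_solve_right l_zero r_neg zero_closed)

lemma mod_homI:
  assumes "\<And>x. x \<in> carrier M \<Longrightarrow> h x \<in> carrier N"
    and "\<And>x y. x \<in> carrier M \<Longrightarrow> y \<in> carrier M \<Longrightarrow> h (x \<oplus>\<^bsub>M\<^esub> y) = h x \<oplus>\<^bsub>N\<^esub> h y"
    and "\<And>a x. a \<in> carrier R \<Longrightarrow> x \<in> carrier M \<Longrightarrow> h (a \<odot>\<^bsub>M\<^esub> x) = a \<odot>\<^bsub>N\<^esub> h x"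
  shows "h \<in> mod_hom R M N"
  using assms by (auto simp: mod_hom_def)

lemma mod_homD:
  assumes "h \<in> mod_hom R M N"
  shows "x \<in> carrier M \<Longrightarrow> h x \<in> carrier N"
    and "x \<in> carrier M \<Longrightarrow> y \<in> carrier M \<Longrightarrow> h (x \<oplus>\<^bsub>M\<^esub> y) = h x \<oplus>\<^bsub>N\<^esub> h y"
    and "a \<in> carrier R \<Longrightarrow> x \<in> carrier M \<Longrightarrow> h (a \<odot>\<^bsub>M\<^esub> x) = a \<odot>\<^bsub>N\<^esub> h x"
  using assms by (auto simp: mod_hom_def)

text \<open>The value at zero is not part of \<open>mod_hom\<close>; it comes from linearity with
  the scalar zero.\<close>

lemma mod_hom_zero:
  assumes "module R M" "module R N" "h \<in> mod_hom R M N"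
  shows "h \<zero>\<^bsub>M\<^esub> = \<zero>\<^bsub>N\<^esub>"
proof -
  interpret M: module R M by fact
  interpret N: module R N by fact
  have "h (\<zero>\<^bsub>R\<^esub> \<odot>\<^bsub>M\<^esub> \<zero>\<^bsub>M\<^esub>) = \<zero>\<^bsub>R\<^esub> \<odot>\<^bsub>N\<^esub> h \<zero>\<^bsub>M\<^esub>"
    by (rule mod_homD(3)[OF assms(3)]) auto
  then show ?thesis using mod_homD(1)[OF assms(3)] by simp
qed

lemma mod_hom_uminus:
  assumes "module R M" "module R N" "h \<in> mod_hom R M N" "x \<in> carrier M"
  shows "h (\<ominus>\<^bsub>M\<^esub> x) = \<ominus>\<^bsub>N\<^esub> h x"
proof -
  interpret M: module R M by fact
  interpret N: module R N by fact
  have "h (\<ominus>\<^bsub>M\<^esub> x) \<oplus>\<^bsub>N\<^esub> h x = \<zero>\<^bsub>N\<^esub>"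
    using mod_homD(2)[OF assms(3), of "\<ominus>\<^bsub>M\<^esub> x" x] mod_hom_zero[OF assms(1-3)] assms(4)
    by (simp add: M.M.l_neg)
  then show ?thesis
    using mod_homD(1)[OF assms(3)] assms(4) by (metis N.M.minus_equality M.M.a_inv_closed)
qed

lemma mod_hom_minus:
  assumes "module R M" "module R N" "h \<in> mod_hom R M N" "x \<in> carrier M" "y \<in> carrier M"
  shows "h (x \<ominus>\<^bsub>M\<^esub> y) = h x \<ominus>\<^bsub>N\<^esub> h y"
proof -
  interpret M: module R M by fact
  show ?thesis
    using assms mod_hom_uminus[OF assms(1-3,5)] mod_homD(2)[OF assms(3)]
    by (simp add: a_minus_def)
qed

lemma mod_hom_inj_on:
  assumes "module R M" "module R N" "h \<in> mod_hom R M N"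
    and ker: "\<And>x. x \<in> carrier M \<Longrightarrow> h x = \<zero>\<^bsub>N\<^esub> \<Longrightarrow> x = \<zero>\<^bsub>M\<^esub>"
  shows "inj_on h (carrier M)"
proof (rule inj_onI)
  interpret M: module R M by fact
  interpret N: module R N by fact
  fix x y assume xy: "x \<in> carrier M" "y \<in> carrier M" "h x = h y"
  have "h (x \<ominus>\<^bsub>M\<^esub> y) = \<zero>\<^bsub>N\<^esub>"
    using xy mod_hom_minus[OF assms(1-3) xy(1,2)] mod_homD(1)[OF assms(3)]
    by (simp add: N.M.r_neg a_minus_def)
  then have "x \<ominus>\<^bsub>M\<^esub> y = \<zero>\<^bsub>M\<^esub>" using ker xy by simp
  then show "x = y" using xy M.M.minus_eq_zero_iff by simp
qed

text \<open>A submodule is by definition an additive subgroup stable under scalars. Negation is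
  scaling by minus one, so closure under inverses need not be checked separately; this is the
  working criterion for all submodules below.\<close>

lemma submodule_iff:
  assumes "module R M"
  shows "submodule H R M \<longleftrightarrow> H \<subseteq> carrier M \<and> \<zero>\<^bsub>M\<^esub> \<in> H \<and> (\<forall>x\<in>H. \<forall>y\<in>H. x \<oplus>\<^bsub>M\<^esub> y \<in> H)
    \<and> (\<forall>a\<in>carrier R. \<forall>x\<in>H. a \<odot>\<^bsub>M\<^esub> x \<in> H)"
proof -
  interpret M: module R M by fact
  have "\<ominus>\<^bsub>M\<^esub> x \<in> H" if "x \<in> carrier M" "\<forall>a\<in>carrier R. \<forall>x\<in>H. a \<odot>\<^bsub>M\<^esub> x \<in> H" "x \<in> H" for x
    using that M.smult_l_minus[of "\<one>\<^bsub>R\<^esub>" x] by (metis M.R.a_inv_closed M.R.one_closed M.smult_one)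
  then show ?thesis
    using M.submoduleE[of H] M.submoduleI[of H]
      subgroup.one_closed[OF submodule.axioms(1), of H R M]
    by (smt (verit, best) monoid.select_convs(2) subsetD)
qed

lemma submodule_minus:
  assumes "module R M" "submodule H R M" "x \<in> H" "y \<in> H"
  shows "x \<ominus>\<^bsub>M\<^esub> y \<in> H"
  using assms module.submoduleE[OF assms(1,2)] by (simp add: a_minus_def)

lemma submodule_vimage:
  assumes "module R M" "module R N" "h \<in> mod_hom R M N" "submodule H R N"
  shows "submodule {x \<in> carrier M. h x \<in> H} R M"
proof -
  interpret M: module R M by fact
  show ?thesis
    using assms mod_hom_zero[OF assms(1-3)] mod_homD[OF assms(3)]
    by (auto simp: submodule_iff)
qed

lemma submodule_kernel:
  assumes "module R M" "module R N" "h \<in> mod_hom R M N"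
  shows "submodule {x \<in> carrier M. h x = \<zero>\<^bsub>N\<^esub>} R M"
proof -
  interpret N: module R N by fact
  have "submodule {\<zero>\<^bsub>N\<^esub>} R N" using assms by (auto simp: submodule_iff)
  from submodule_vimage[OF assms this] show ?thesis by simp
qed

lemma submodule_image:
  assumes "module R M" "module R N" "h \<in> mod_hom R M N"
  shows "submodule (h ` carrier M) R N"
proof -
  interpret M: module R M by fact
  have "\<zero>\<^bsub>N\<^esub> \<in> h ` carrier M"
    using mod_hom_zero[OF assms] by (metis M.M.zero_closed image_eqI)
  then show ?thesis
    using assms mod_homD[OF assms(3)]
    by (auto simp: submodule_iff) (metis M.M.add.m_closed image_eqI, metis M.smult_closed image_eqI)
qed

lemma submodule_mod_span:
  assumes "module R M" "S \<subseteq> carrier M"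
  shows "submodule (mod_span R M S) R M"
  using assms module.carrier_is_submodule[OF assms(1)]
  by (auto simp: submodule_iff mod_span_def)

lemma mod_span_superset: "S \<subseteq> mod_span R M S"
  by (auto simp: mod_span_def)

lemma mod_span_minimal: "submodule H R M \<Longrightarrow> S \<subseteq> H \<Longrightarrow> mod_span R M S \<subseteq> H"
  by (auto simp: mod_span_def)

section \<open>Quotient modules\<close>

lemma abelian_subgroup_submodule:
  assumes "module R M" "submodule H R M"
  shows "abelian_subgroup H M"
  using assms
  by (intro abelian_subgroupI3 additive_subgroupI submodule.axioms(1) module.axioms(2))

lemma quot_module_carrier: "carrier (quot_module M H) = (\<lambda>x. H +>\<^bsub>M\<^esub> x) ` carrier M"
  by (auto simp: quot_module_def A_RCOSETS_def')

lemma quot_module_coset_eq_iff: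
  assumes "module R M" "submodule H R M" "x \<in> carrier M" "y \<in> carrier M"
  shows "H +>\<^bsub>M\<^esub> x = H +>\<^bsub>M\<^esub> y \<longleftrightarrow> x \<ominus>\<^bsub>M\<^esub> y \<in> H"
proof -
  interpret M: module R M by fact
  interpret H: abelian_subgroup H M using abelian_subgroup_submodule assms by blast
  have "x \<in> H +>\<^bsub>M\<^esub> y \<longleftrightarrow> x \<ominus>\<^bsub>M\<^esub> y \<in> H"
    using assms H.a_rcos_module_minus by (simp add: M.R.ring_axioms H.a_rcos_module a_minus_def)
  then show ?thesis
    using assms H.a_rcos_self M.a_repr_independence H.a_subgroup by metis
qed

lemma quot_module_coset_eq_self_iff:
  assumes "module R M" "submodule H R M" "x \<in> carrier M"
  shows "H +>\<^bsub>M\<^esub> x = H \<longleftrightarrow> x \<in> H"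
proof -
  interpret M: module R M by fact
  interpret H: abelian_subgroup H M using abelian_subgroup_submodule assms by blast
  show ?thesis using assms M.a_coset_join1 M.a_coset_join2 H.a_subgroup by blast
qed

lemma quot_module_add:
  assumes "module R M" "submodule H R M" "x \<in> carrier M" "y \<in> carrier M"
  shows "(H +>\<^bsub>M\<^esub> x) \<oplus>\<^bsub>quot_module M H\<^esub> (H +>\<^bsub>M\<^esub> y) = H +>\<^bsub>M\<^esub> (x \<oplus>\<^bsub>M\<^esub> y)"
proof -
  interpret H: abelian_subgroup H M using abelian_subgroup_submodule assms by blast
  show ?thesis using assms H.a_rcos_sum by (simp add: quot_module_def)
qed

text \<open>The scalar action on a coset is a union over all its representatives, which avoids a
  choice. Two representatives differ by an element of \<open>H\<close>, and so do their multiples;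
  all members of the union therefore coincide.\<close>

lemma quot_module_smult:
  assumes "module R M" "submodule H R M" "a \<in> carrier R" "x \<in> carrier M"
  shows "a \<odot>\<^bsub>quot_module M H\<^esub> (H +>\<^bsub>M\<^esub> x) = H +>\<^bsub>M\<^esub> (a \<odot>\<^bsub>M\<^esub> x)"
proof -
  interpret M: module R M by fact
  interpret H: abelian_subgroup H M using abelian_subgroup_submodule assms by blast
  have "H +>\<^bsub>M\<^esub> (a \<odot>\<^bsub>M\<^esub> y) = H +>\<^bsub>M\<^esub> (a \<odot>\<^bsub>M\<^esub> x)" if y: "y \<in> H +>\<^bsub>M\<^esub> x" for y
  proof -
    have yc: "y \<in> carrier M" using y assms(4) H.a_elemrcos_carrier by blast
    have "H +>\<^bsub>M\<^esub> y = H +>\<^bsub>M\<^esub> x"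
      using y assms M.a_repr_independence H.a_subgroup by metis
    then have "y \<ominus>\<^bsub>M\<^esub> x \<in> H" using quot_module_coset_eq_iff assms yc by metis
    then have "a \<odot>\<^bsub>M\<^esub> (y \<ominus>\<^bsub>M\<^esub> x) \<in> H" using M.submoduleE(4)[OF assms(2)] assms by blast
    moreover have "a \<odot>\<^bsub>M\<^esub> (y \<ominus>\<^bsub>M\<^esub> x) = a \<odot>\<^bsub>M\<^esub> y \<ominus>\<^bsub>M\<^esub> a \<odot>\<^bsub>M\<^esub> x"
      using yc assms by (simp add: a_minus_def M.smult_r_distr M.smult_r_minus)
    ultimately show ?thesis using quot_module_coset_eq_iff[OF assms(1,2)] yc assms by simp
  qed
  moreover have "x \<in> H +>\<^bsub>M\<^esub> x" using H.a_rcos_self assms by blast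
  ultimately have "(\<Union>y\<in>H +>\<^bsub>M\<^esub> x. H +>\<^bsub>M\<^esub> (a \<odot>\<^bsub>M\<^esub> y)) = H +>\<^bsub>M\<^esub> (a \<odot>\<^bsub>M\<^esub> x)" by blast
  then show ?thesis by (simp add: quot_module_def)
qed

lemma module_quot_module:
  assumes "module R M" "submodule H R M"
  shows "module R (quot_module M H)"
proof -
  interpret M: module R M by fact
  note add = quot_module_add[OF assms] and smult = quot_module_smult[OF assms]
  have zero: "\<zero>\<^bsub>quot_module M H\<^esub> = H +>\<^bsub>M\<^esub> \<zero>\<^bsub>M\<^esub>"
    using M.submoduleE(1)[OF assms(2)] M.M.a_coset_add_zero by (simp add: quot_module_def)
  show ?thesis
  proof (rule moduleI)
    show "abelian_group (quot_module M H)"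
    proof (rule abelian_groupI)
      fix x assume "x \<in> carrier (quot_module M H)"
      then obtain x' where "x' \<in> carrier M" "x = H +>\<^bsub>M\<^esub> x'" by (auto simp: quot_module_carrier)
      then show "\<exists>y\<in>carrier (quot_module M H). y \<oplus>\<^bsub>quot_module M H\<^esub> x = \<zero>\<^bsub>quot_module M H\<^esub>"
        by (intro bexI[of _ "H +>\<^bsub>M\<^esub> (\<ominus>\<^bsub>M\<^esub> x')"])
          (auto simp: quot_module_carrier add zero M.M.l_neg)
    qed (auto simp: quot_module_carrier add zero M.M.a_ac)
  qed (auto simp: quot_module_carrier add zero smult M.smult_l_distr M.smult_r_distr M.smult_assoc1
        M.R.is_cring)
qed

lemma mod_hom_coset:
  assumes "module R M" "submodule H R M"
  shows "(\<lambda>x. H +>\<^bsub>M\<^esub> x) \<in> mod_hom R M (quot_module M H)"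
  using assms
  by (intro mod_homI) (auto simp: quot_module_carrier quot_module_add quot_module_smult)

section \<open>The ring as a module over itself; colon ideals and annihilators\<close>

lemma module_ring_as_module:
  fixes R (structure)
  assumes "cring R" shows "module R (ring_as_module R)"
proof -
  interpret cring R by fact
  show ?thesis
    by (intro moduleI abelian_groupI)
      (auto simp: ring_as_module_def cring_axioms l_distr r_distr m_assoc a_ac
        intro!: bexI[of _ "\<ominus> x" for x] l_neg)
qed

lemma submodule_ideal:
  assumes "cring R" "ideal I R" shows "submodule I R (ring_as_module R)"
proof -
  interpret ideal I R by fact
  show ?thesis
    unfolding submodule_iff[OF module_ring_as_module[OF assms(1)]]
    using a_subset by (auto simp: ring_as_module_def I_l_closed)
qed

lemma ideal_if_submodule:
  fixes R (structure)
  assumes "cring R" "submodule H R (ring_as_module R)" shows "ideal H R"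
proof -
  interpret cring R by fact
  have H: "H \<subseteq> carrier R" "\<zero> \<in> H" "\<And>a b. a \<in> H \<Longrightarrow> b \<in> H \<Longrightarrow> a \<oplus> b \<in> H"
    "\<And>a b. a \<in> carrier R \<Longrightarrow> b \<in> H \<Longrightarrow> a \<otimes> b \<in> H"
    using assms(2) unfolding submodule_iff[OF module_ring_as_module[OF assms(1)]]
    by (auto simp: ring_as_module_def)
  have "\<ominus> b \<in> H" if "b \<in> H" for b
    using H(4)[of "\<ominus> \<one>" b] H(1) that by (auto simp: l_minus)
  then have "subgroup H (add_monoid R)"
    using H(1-3) by (intro add.subgroupI) (auto simp: a_inv_def)
  moreover have "b \<otimes> a \<in> H" if "b \<in> H" "a \<in> carrier R" for a b
    using H(4)[OF that(2,1)] H(1) that m_comm[of a b] by auto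
  ultimately show ?thesis
    using H(4) by (intro idealI ring_axioms) auto
qed

lemma mod_hom_smult_right:
  assumes "module R M" "x \<in> carrier M"
  shows "(\<lambda>a. a \<odot>\<^bsub>M\<^esub> x) \<in> mod_hom R (ring_as_module R) M"
proof -
  interpret M: module R M by fact
  show ?thesis using assms(2)
    by (intro mod_homI) (simp_all add: ring_as_module_def M.smult_l_distr M.smult_assoc1)
qed

text \<open>This is the colon ideal (H : x), obtained as the preimage of \<open>H\<close> under the
  homomorphism a |-> a x from the ring. Annihilators are the case of the zero submodule.\<close>

lemma ideal_transporter:
  assumes "module R M" "x \<in> carrier M" "submodule H R M"
  shows "ideal {a \<in> carrier R. a \<odot>\<^bsub>M\<^esub> x \<in> H} R"
proof -
  interpret M: module R M by fact
  have "submodule {a \<in> carrier R. a \<odot>\<^bsub>M\<^esub> x \<in> H} R (ring_as_module R)"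
    using submodule_vimage[OF module_ring_as_module assms(1) mod_hom_smult_right[OF assms(1,2)] assms(3)]
    by (simp add: ring_as_module_def M.R.is_cring)
  then show ?thesis by (rule ideal_if_submodule[OF M.R.is_cring])
qed

lemma ideal_annihilator:
  assumes "module R M" "x \<in> carrier M"
  shows "ideal {a \<in> carrier R. a \<odot>\<^bsub>M\<^esub> x = \<zero>\<^bsub>M\<^esub>} R"
proof -
  interpret M: module R M by fact
  have "submodule {\<zero>\<^bsub>M\<^esub>} R M" by (simp add: submodule_iff[OF assms(1)])
  from ideal_transporter[OF assms this] show ?thesis by simp
qed

section \<open>Comparison of short exact sequences\<close>

lemma mod_iso_id: "(\<lambda>x. x) \<in> mod_iso R M M"
  by (auto simp: mod_iso_def mod_hom_def bij_betw_def)

text \<open>With the identity in the middle, the outer isomorphisms are forced. On the left it is f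
  followed by the inverse of f', defined because both injections have the same image. On the right
  it sends g y to g' y, which is well defined and injective because g and g' identify the same
  pairs.\<close>

lemma sequences_isomorphic_if_same_kernel:
  assumes "short_exact R A f B g C" "short_exact R A' f' B g' C'"
    and same: "f ` carrier A = f' ` carrier A'"
  shows "sequences_isomorphic R A f B g C A' f' B g' C'"
proof -
  from assms(1) have A: "module R A" and B: "module R B" and C: "module R C"
    and f: "f \<in> mod_hom R A B" and g: "g \<in> mod_hom R B C" and inj: "inj_on f (carrier A)"
    and ker: "f ` carrier A = {y \<in> carrier B. g y = \<zero>\<^bsub>C\<^esub>}" and surj: "g ` carrier B = carrier C"
    by (simp_all add: short_exact_def)
  from assms(2) have A': "module R A'" and C': "module R C'"
    and f': "f' \<in> mod_hom R A' B" and g': "g' \<in> mod_hom R B C'" and inj': "inj_on f' (carrier A')"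
    and ker': "f' ` carrier A' = {y \<in> carrier B. g' y = \<zero>\<^bsub>C'\<^esub>}"
    and surj': "g' ` carrier B = carrier C'"
    by (simp_all add: short_exact_def)
  interpret A: module R A by fact
  interpret B: module R B by fact
  interpret C: module R C by fact
  interpret A': module R A' by fact
  interpret C': module R C' by fact
  \<comment> \<open>Both equations say that the difference of x and y lies in the kernel, and
    exactness makes the two kernels equal to the common image.\<close>
  have eq_iff: "g x = g y \<longleftrightarrow> g' x = g' y" if "x \<in> carrier B" "y \<in> carrier B" for x y
  proof -
    have "g x = g y \<longleftrightarrow> g (x \<ominus>\<^bsub>B\<^esub> y) = \<zero>\<^bsub>C\<^esub>"
      using that mod_hom_minus[OF B C g] mod_homD(1)[OF g] by (simp add: C.M.minus_eq_zero_iff)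
    also have "\<dots> \<longleftrightarrow> g' (x \<ominus>\<^bsub>B\<^esub> y) = \<zero>\<^bsub>C'\<^esub>"
      using ker ker' same B.M.minus_closed[OF that] by (metis (mono_tags, lifting) mem_Collect_eq)
    also have "\<dots> \<longleftrightarrow> g' x = g' y"
      using that mod_hom_minus[OF B C' g'] mod_homD(1)[OF g'] by (simp add: C'.M.minus_eq_zero_iff)
    finally show ?thesis .
  qed
  define \<alpha> where "\<alpha> = (\<lambda>x. inv_into (carrier A') f' (f x))"
  define \<gamma> where "\<gamma> = (\<lambda>z. g' (inv_into (carrier B) g z))"
  have \<alpha>: "\<alpha> x \<in> carrier A'" "f' (\<alpha> x) = f x" if "x \<in> carrier A" for x
    using imageI[OF that, of f] unfolding same \<alpha>_def by (rule inv_into_into, rule f_inv_into_f)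
  have \<gamma>: "\<gamma> (g y) = g' y" if "y \<in> carrier B" for y
  proof -
    have "inv_into (carrier B) g (g y) \<in> carrier B" "g (inv_into (carrier B) g (g y)) = g y"
      using that by (auto intro: inv_into_into f_inv_into_f)
    then show ?thesis using eq_iff[of "inv_into (carrier B) g (g y)" y] that by (simp add: \<gamma>_def)
  qed
  have "\<alpha> \<in> mod_iso R A A'"
    unfolding mod_iso_def
  proof (safe intro!: mod_homI)
    fix x y assume "x \<in> carrier A" "y \<in> carrier A"
    then show "\<alpha> (x \<oplus>\<^bsub>A\<^esub> y) = \<alpha> x \<oplus>\<^bsub>A'\<^esub> \<alpha> y"
      by (intro inj_onD[OF inj']) (simp_all add: \<alpha> mod_homD(2)[OF f] mod_homD(2)[OF f'])
  next
    fix a x assume "a \<in> carrier R" "x \<in> carrier A"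
    then show "\<alpha> (a \<odot>\<^bsub>A\<^esub> x) = a \<odot>\<^bsub>A'\<^esub> \<alpha> x"
      by (intro inj_onD[OF inj']) (simp_all add: \<alpha> mod_homD(3)[OF f] mod_homD(3)[OF f'])
  next
    show "bij_betw \<alpha> (carrier A) (carrier A')"
    proof (rule bij_betw_imageI)
      show "inj_on \<alpha> (carrier A)"
        using \<alpha>(2) inj_onD[OF inj] by (metis inj_onI)
      show "\<alpha> ` carrier A = carrier A'"
      proof (safe intro!: \<alpha>)
        fix y assume y: "y \<in> carrier A'"
        then obtain x where "x \<in> carrier A" "f' y = f x" using same by (metis imageE imageI)
        then show "y \<in> \<alpha> ` carrier A"
          using y \<alpha> inj' by (metis imageI inj_onD)
      qed
    qed
  qed (simp add: \<alpha>)
  moreover have "(\<lambda>x. x) \<in> mod_iso R B B"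
    by (rule mod_iso_id)
  moreover have "\<gamma> \<in> mod_iso R C C'"
    unfolding mod_iso_def
  proof (safe intro!: mod_homI)
    fix x assume "x \<in> carrier C"
    then obtain u where "u \<in> carrier B" "x = g u" using surj by auto
    then show "\<gamma> x \<in> carrier C'" by (simp add: \<gamma> mod_homD(1)[OF g'])
  next
    fix x y assume "x \<in> carrier C" "y \<in> carrier C"
    then obtain u v where "u \<in> carrier B" "v \<in> carrier B" "x = g u" "y = g v"
      using surj by (metis imageE)
    then show "\<gamma> (x \<oplus>\<^bsub>C\<^esub> y) = \<gamma> x \<oplus>\<^bsub>C'\<^esub> \<gamma> y"
      by (simp add: \<gamma> mod_homD(2)[OF g'] flip: mod_homD(2)[OF g])
  next
    fix a x assume "a \<in> carrier R" "x \<in> carrier C"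
    then obtain u where "u \<in> carrier B" "x = g u" using surj by auto
    with \<open>a \<in> carrier R\<close> show "\<gamma> (a \<odot>\<^bsub>C\<^esub> x) = a \<odot>\<^bsub>C'\<^esub> \<gamma> x"
      by (simp add: \<gamma> mod_homD(3)[OF g'] flip: mod_homD(3)[OF g])
  next
    show "bij_betw \<gamma> (carrier C) (carrier C')"
    proof (rule bij_betw_imageI)
      show "inj_on \<gamma> (carrier C)"
        unfolding surj[symmetric] using eq_iff by (auto intro!: inj_onI simp: \<gamma>)
      have "\<gamma> ` g ` carrier B = g' ` carrier B"
        using \<gamma> by (auto simp: image_image)
      then show "\<gamma> ` carrier C = carrier C'" using surj surj' by simp
    qed
  qed
  ultimately show ?thesis
    unfolding sequences_isomorphic_def using \<alpha>(2) \<gamma> by (intro bexI conjI ballI) auto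
qed

section \<open>Tensor products\<close>

lemma module_free_module:
  fixes R (structure)
  assumes "cring R" shows "module R (free_module R I)"
proof -
  interpret cring R by fact
  let ?F = "free_module R I"
  have closed: "(\<lambda>i. f i \<oplus> g i) \<in> carrier ?F" if "f \<in> carrier ?F" "g \<in> carrier ?F" for f g
  proof -
    have "{i. f i \<oplus> g i \<noteq> \<zero>} \<subseteq> {i. f i \<noteq> \<zero>} \<union> {i. g i \<noteq> \<zero>}" by auto
    then show ?thesis using that by (auto simp: free_module_def intro: finite_subset)
  qed
  have sclosed: "(\<lambda>i. a \<otimes> f i) \<in> carrier ?F" if "a \<in> carrier R" "f \<in> carrier ?F" for a f
  proof -
    have "{i. a \<otimes> f i \<noteq> \<zero>} \<subseteq> {i. f i \<noteq> \<zero>}" using that by auto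
    then show ?thesis using that by (auto simp: free_module_def intro: finite_subset)
  qed
  have val: "f i \<in> carrier R" if "f \<in> carrier ?F" for f i
    using that by (cases "i \<in> I") (auto simp: free_module_def)
  have ops: "f \<oplus>\<^bsub>?F\<^esub> g = (\<lambda>i. f i \<oplus> g i)" "a \<odot>\<^bsub>?F\<^esub> f = (\<lambda>i. a \<otimes> f i)" "\<zero>\<^bsub>?F\<^esub> = (\<lambda>_. \<zero>)" for f g a
    by (simp_all add: free_module_def)
  show ?thesis
  proof (intro moduleI abelian_groupI)
    fix f assume f: "f \<in> carrier ?F"
    show "\<exists>g\<in>carrier ?F. g \<oplus>\<^bsub>?F\<^esub> f = \<zero>\<^bsub>?F\<^esub>"
    proof (rule bexI)
      \<comment> \<open>The additive inverse is written as scaling by minus one, so that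
        \<open>sclosed\<close> applies.\<close>
      show "(\<lambda>i. \<ominus> \<one> \<otimes> f i) \<in> carrier ?F" using f by (intro sclosed) auto
      show "(\<lambda>i. \<ominus> \<one> \<otimes> f i) \<oplus>\<^bsub>?F\<^esub> f = \<zero>\<^bsub>?F\<^esub>"
        using val[OF f] by (simp add: ops l_minus l_neg)
    qed
    show "\<zero>\<^bsub>?F\<^esub> \<oplus>\<^bsub>?F\<^esub> f = f" "\<one> \<odot>\<^bsub>?F\<^esub> f = f"
      using val[OF f] by (simp_all add: ops)
  qed (auto simp: ops closed sclosed cring_axioms val l_distr r_distr m_assoc a_ac,
      simp add: free_module_def)
qed

lemma free_gen_closed: "cring R \<Longrightarrow> i \<in> I \<Longrightarrow> free_gen R i \<in> carrier (free_module R I)"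
  by (auto simp: free_gen_def free_module_def cring.cring_simprules)

text \<open>The existence half of the universal property; it suffices because the map is used only
  through its values on generators and its kernel.\<close>

lemma free_module_universal:
  fixes I :: "'i set"
  assumes "module R M" "g \<in> I \<rightarrow> carrier M"
  obtains \<Phi> where "\<Phi> \<in> mod_hom R (free_module R I) M" "\<And>i. i \<in> I \<Longrightarrow> \<Phi> (free_gen R i) = g i"
proof -
  interpret module R M by fact
  let ?F = "free_module R I"
  define supp where "supp f = {i. f i \<noteq> \<zero>\<^bsub>R\<^esub>}" for f :: "'i \<Rightarrow> 'a"
  define \<Phi> where "\<Phi> f = (\<Oplus>\<^bsub>M\<^esub>i\<in>supp f. f i \<odot>\<^bsub>M\<^esub> g i)" for f
  have val: "f i \<in> carrier R" and gval: "i \<in> supp f \<Longrightarrow> g i \<in> carrier M"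
    and finsupp: "finite (supp f)" if "f \<in> carrier ?F" for f i
    using that assms(2) by (cases "i \<in> I"; force simp: free_module_def supp_def)+
  \<comment> \<open>Additivity involves the supports of two elements and of their sum. Replacing
    each by a common finite superset makes the sums comparable; the superset stays within
    \<open>I\<close>, where \<open>g\<close> has values in the module.\<close>
  have \<Phi>_superset: "\<Phi> f = (\<Oplus>\<^bsub>M\<^esub>i\<in>J. f i \<odot>\<^bsub>M\<^esub> g i)"
    if "f \<in> carrier ?F" "finite J" "supp f \<subseteq> J" "J \<subseteq> I" for f J
    unfolding \<Phi>_def using that assms(2) val
    by (intro M.add.finprod_mono_neutral_cong_left) (auto simp: supp_def Pi_iff)
  have F_simps: "(f \<oplus>\<^bsub>?F\<^esub> h) i = f i \<oplus>\<^bsub>R\<^esub> h i" "(a \<odot>\<^bsub>?F\<^esub> f) i = a \<otimes>\<^bsub>R\<^esub> f i" for f h a i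
    by (simp_all add: free_module_def)
  have suppI: "supp f \<subseteq> I" if "f \<in> carrier ?F" for f
    using that by (auto simp: free_module_def supp_def)
  have "\<Phi> \<in> mod_hom R ?F M"
  proof (rule mod_homI)
    fix f h assume f: "f \<in> carrier ?F" and h: "h \<in> carrier ?F"
    let ?J = "supp f \<union> supp h"
    have J: "finite ?J" "?J \<subseteq> I" using f h finsupp suppI by auto
    have fh: "f \<oplus>\<^bsub>?F\<^esub> h \<in> carrier ?F"
      using f h module.axioms(2)[OF module_free_module[OF R.is_cring]]
      by (rule_tac abelian_groupE(1))
    have "supp (f \<oplus>\<^bsub>?F\<^esub> h) \<subseteq> ?J" by (auto simp: supp_def F_simps)
    then have "\<Phi> (f \<oplus>\<^bsub>?F\<^esub> h) = (\<Oplus>\<^bsub>M\<^esub>i\<in>?J. (f \<oplus>\<^bsub>?F\<^esub> h) i \<odot>\<^bsub>M\<^esub> g i)"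
      using \<Phi>_superset fh J by blast
    also have "\<dots> = (\<Oplus>\<^bsub>M\<^esub>i\<in>?J. f i \<odot>\<^bsub>M\<^esub> g i \<oplus>\<^bsub>M\<^esub> h i \<odot>\<^bsub>M\<^esub> g i)"
      using val[OF f] val[OF h] gval[OF f] gval[OF h]
      by (intro M.finsum_cong') (auto simp: F_simps smult_l_distr)
    also have "\<dots> = \<Phi> f \<oplus>\<^bsub>M\<^esub> \<Phi> h"
      using \<Phi>_superset[OF f J(1) _ J(2)] \<Phi>_superset[OF h J(1) _ J(2)]
        val[OF f] val[OF h] gval[OF f] gval[OF h]
      by (subst M.finsum_addf) auto
    finally show "\<Phi> (f \<oplus>\<^bsub>?F\<^esub> h) = \<Phi> f \<oplus>\<^bsub>M\<^esub> \<Phi> h" .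
  next
    fix a f assume a: "a \<in> carrier R" and f: "f \<in> carrier ?F"
    have af: "a \<odot>\<^bsub>?F\<^esub> f \<in> carrier ?F"
      using a f module.smult_closed[OF module_free_module[OF R.is_cring]] by blast
    have "supp (a \<odot>\<^bsub>?F\<^esub> f) \<subseteq> supp f" using a by (auto simp: supp_def F_simps)
    then have "\<Phi> (a \<odot>\<^bsub>?F\<^esub> f) = (\<Oplus>\<^bsub>M\<^esub>i\<in>supp f. (a \<odot>\<^bsub>?F\<^esub> f) i \<odot>\<^bsub>M\<^esub> g i)"
      using \<Phi>_superset af f suppI finsupp by blast
    also have "\<dots> = (\<Oplus>\<^bsub>M\<^esub>i\<in>supp f. a \<odot>\<^bsub>M\<^esub> (f i \<odot>\<^bsub>M\<^esub> g i))"
      using a val[OF f] gval[OF f] by (intro M.finsum_cong') (auto simp: F_simps smult_assoc1)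
    also have "\<dots> = a \<odot>\<^bsub>M\<^esub> \<Phi> f"
      unfolding \<Phi>_def using a val[OF f] gval[OF f] finsupp[OF f]
      by (subst finsum_smult_ldistr) auto
    finally show "\<Phi> (a \<odot>\<^bsub>?F\<^esub> f) = a \<odot>\<^bsub>M\<^esub> \<Phi> f" .
  qed (auto simp: \<Phi>_def val gval)
  moreover have "\<Phi> (free_gen R i) = g i" if "i \<in> I" for i
  proof -
    have "\<Phi> (free_gen R i) = (\<Oplus>\<^bsub>M\<^esub>j\<in>{i}. free_gen R i j \<odot>\<^bsub>M\<^esub> g j)"
      using that free_gen_closed[OF R.is_cring that]
      by (intro \<Phi>_superset) (auto simp: supp_def free_gen_def)
    also have "\<dots> = g i"
      using that assms(2) by (simp add: free_gen_def Pi_iff)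
    finally show ?thesis .
  qed
  ultimately show ?thesis using that by blast
qed

text \<open>Induction over a finite set containing the support: clearing the coordinate j subtracts
  a multiple of the generator at j.\<close>

lemma submodule_free_module_eq_carrier:
  fixes R (structure)
  assumes "cring R" "submodule H R (free_module R I)" "\<And>i. i \<in> I \<Longrightarrow> free_gen R i \<in> H"
  shows "H = carrier (free_module R I)"
proof -
  interpret cring R by fact
  let ?F = "free_module R I"
  have H: "H \<subseteq> carrier ?F" "\<zero>\<^bsub>?F\<^esub> \<in> H" "\<And>x y. x \<in> H \<Longrightarrow> y \<in> H \<Longrightarrow> x \<oplus>\<^bsub>?F\<^esub> y \<in> H"
    "\<And>a x. a \<in> carrier R \<Longrightarrow> x \<in> H \<Longrightarrow> a \<odot>\<^bsub>?F\<^esub> x \<in> H"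
    using assms(2) unfolding submodule_iff[OF module_free_module[OF assms(1)]] by auto
  have "f \<in> H" if "finite J" "f \<in> carrier ?F" "{i. f i \<noteq> \<zero>} \<subseteq> J" for J f
    using that
  proof (induction J arbitrary: f)
    case empty
    then have "f = \<zero>\<^bsub>?F\<^esub>" by (auto simp: free_module_def)
    then show ?case using H by simp
  next
    case (insert j J)
    show ?case
    proof (cases "f j = \<zero>")
      case True
      then show ?thesis using insert by blast
    next
      case False
      then have j: "j \<in> I" and fj: "f j \<in> carrier R"
        using insert.prems by (auto simp: free_module_def)
      define h where "h = f(j := \<zero>)"
      have h: "h \<in> carrier ?F"
      proof -
        have "finite {i. h i \<noteq> \<zero>}"
          using insert.prems(1) by (rule_tac finite_subset[of _ "{i. f i \<noteq> \<zero>}"])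
            (auto simp: h_def free_module_def)
        moreover have "\<forall>i\<in>I. h i \<in> carrier R" "\<forall>i. i \<notin> I \<longrightarrow> h i = \<zero>"
          using insert.prems(1) by (auto simp: h_def free_module_def)
        ultimately show ?thesis by (simp add: free_module_def)
      qed
      have "f i \<in> carrier R" for i using insert.prems by (cases "i \<in> I") (auto simp: free_module_def)
      then have "f = h \<oplus>\<^bsub>?F\<^esub> f j \<odot>\<^bsub>?F\<^esub> free_gen R j"
        by (auto simp: free_module_def free_gen_def h_def)
      moreover have "h \<in> H" using insert.prems h by (intro insert.IH[OF h]) (auto simp: h_def)
      ultimately show ?thesis using H fj assms(3) j by metis
    qed
  qed
  then show ?thesis using H(1) by (auto simp: free_module_def)
qed

section \<open>The tensor product by generators and relations\<close>

lemma tensor_relations_subset: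
  assumes "module R A" "module R B"
  shows "tensor_relations R A B \<subseteq> carrier (free_module R (carrier A \<times> carrier B))"
proof -
  interpret A: module R A by fact
  interpret B: module R B by fact
  interpret F: module R "free_module R (carrier A \<times> carrier B)"
    by (rule module_free_module[OF A.R.is_cring])
  have "free_gen R (a, b) \<in> carrier (free_module R (carrier A \<times> carrier B))"
    if "a \<in> carrier A" "b \<in> carrier B" for a b
    using that by (intro free_gen_closed A.R.is_cring) auto
  then show ?thesis unfolding tensor_relations_def Let_def by auto
qed

lemma submodule_tensor_kernel:
  assumes "module R A" "module R B"
  shows "submodule (tensor_kernel R A B) R (free_module R (carrier A \<times> carrier B))"
  unfolding tensor_kernel_def
  using assms by (intro submodule_mod_span tensor_relations_subset module_free_module)
    (simp_all add: module.axioms)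

lemma module_tensor_module:
  assumes "module R A" "module R B"
  shows "module R (tensor_module R A B)"
  unfolding tensor_module_def
  using assms by (intro module_quot_module submodule_tensor_kernel module_free_module)
    (simp_all add: module.axioms)

lemma pure_tensor_closed:
  assumes "module R A" "module R B" "a \<in> carrier A" "b \<in> carrier B"
  shows "pure_tensor R A B a b \<in> carrier (tensor_module R A B)"
  unfolding tensor_module_def pure_tensor_def quot_module_carrier
  using assms by (intro imageI free_gen_closed) (auto simp: module.axioms)

text \<open>Each law equates two cosets, and the difference of their representatives belongs to one
  of the four families of relations.\<close>

lemma pure_tensor_bilinear:
  fixes R (structure)
  assumes "module R A" "module R B"
  defines "T \<equiv> tensor_module R A B"
  shows "a \<in> carrier A \<Longrightarrow> a' \<in> carrier A \<Longrightarrow> b \<in> carrier B \<Longrightarrow>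
      pure_tensor R A B (a \<oplus>\<^bsub>A\<^esub> a') b = pure_tensor R A B a b \<oplus>\<^bsub>T\<^esub> pure_tensor R A B a' b"
    and "a \<in> carrier A \<Longrightarrow> b \<in> carrier B \<Longrightarrow> b' \<in> carrier B \<Longrightarrow>
      pure_tensor R A B a (b \<oplus>\<^bsub>B\<^esub> b') = pure_tensor R A B a b \<oplus>\<^bsub>T\<^esub> pure_tensor R A B a b'"
    and "r \<in> carrier R \<Longrightarrow> a \<in> carrier A \<Longrightarrow> b \<in> carrier B \<Longrightarrow>
      pure_tensor R A B (r \<odot>\<^bsub>A\<^esub> a) b = r \<odot>\<^bsub>T\<^esub> pure_tensor R A B a b"
    and "r \<in> carrier R \<Longrightarrow> a \<in> carrier A \<Longrightarrow> b \<in> carrier B \<Longrightarrow>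
      pure_tensor R A B a (r \<odot>\<^bsub>B\<^esub> b) = r \<odot>\<^bsub>T\<^esub> pure_tensor R A B a b"
proof -
  interpret A: module R A by fact
  interpret B: module R B by fact
  let ?F = "free_module R (carrier A \<times> carrier B)"
  have F: "module R ?F" by (rule module_free_module[OF A.R.is_cring])
  interpret F: module R ?F by (rule F)
  note K = submodule_tensor_kernel[OF assms(1,2)]
  have gen: "free_gen R (a, b) \<in> carrier ?F" if "a \<in> carrier A" "b \<in> carrier B" for a b
    using that by (intro free_gen_closed A.R.is_cring) auto
  have "tensor_relations R A B \<subseteq> tensor_kernel R A B"
    by (simp add: tensor_kernel_def mod_span_superset)
  note rel = this[unfolded tensor_relations_def Let_def Un_subset_iff]
  note simps = pure_tensor_def T_def tensor_module_def quot_module_add[OF F K]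
    quot_module_smult[OF F K] quot_module_coset_eq_iff[OF F K] gen
  show "pure_tensor R A B (a \<oplus>\<^bsub>A\<^esub> a') b = pure_tensor R A B a b \<oplus>\<^bsub>T\<^esub> pure_tensor R A B a' b"
    if "a \<in> carrier A" "a' \<in> carrier A" "b \<in> carrier B"
    using that rel by (simp add: simps, blast)
  show "pure_tensor R A B a (b \<oplus>\<^bsub>B\<^esub> b') = pure_tensor R A B a b \<oplus>\<^bsub>T\<^esub> pure_tensor R A B a b'"
    if "a \<in> carrier A" "b \<in> carrier B" "b' \<in> carrier B"
    using that rel by (simp add: simps, blast)
  show "pure_tensor R A B (r \<odot>\<^bsub>A\<^esub> a) b = r \<odot>\<^bsub>T\<^esub> pure_tensor R A B a b"
    if "r \<in> carrier R" "a \<in> carrier A" "b \<in> carrier B"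
    using that rel by (simp add: simps, blast)
  show "pure_tensor R A B a (r \<odot>\<^bsub>B\<^esub> b) = r \<odot>\<^bsub>T\<^esub> pure_tensor R A B a b"
    if "r \<in> carrier R" "a \<in> carrier A" "b \<in> carrier B"
    using that rel by (simp add: simps, blast)
qed

text \<open>The preimage of \<open>H\<close> in the free module contains every generator, hence is
  everything. Surjectivity onto a tensor product can thus be tested on pure tensors.\<close>

lemma submodule_tensor_module_eq_carrier:
  assumes "module R A" "module R B" "submodule H R (tensor_module R A B)"
    and pure: "\<And>a b. a \<in> carrier A \<Longrightarrow> b \<in> carrier B \<Longrightarrow> pure_tensor R A B a b \<in> H"
  shows "H = carrier (tensor_module R A B)"
proof -
  interpret A: module R A by fact
  let ?F = "free_module R (carrier A \<times> carrier B)" and ?K = "tensor_kernel R A B"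
  have F: "module R ?F" by (rule module_free_module[OF A.R.is_cring])
  note K = submodule_tensor_kernel[OF assms(1,2)]
  note T = module_tensor_module[OF assms(1,2)]
  have hom: "(\<lambda>x. ?K +>\<^bsub>?F\<^esub> x) \<in> mod_hom R ?F (tensor_module R A B)"
    unfolding tensor_module_def by (rule mod_hom_coset[OF F K])
  have "{x \<in> carrier ?F. ?K +>\<^bsub>?F\<^esub> x \<in> H} = carrier ?F"
    using pure by (intro submodule_free_module_eq_carrier A.R.is_cring submodule_vimage[OF F T hom assms(3)])
      (auto simp: pure_tensor_def intro!: free_gen_closed A.R.is_cring)
  then show ?thesis
    using module.submoduleE(1)[OF T assms(3)]
    by (auto simp: tensor_module_def quot_module_carrier)
qed

text \<open>The part of the universal property needed for computing a kernel. The linear extension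
  of \<open>\<beta>\<close> to the free module kills all relations, hence the whole tensor kernel,
  and a pure tensor vanishes exactly when its generator lies there. The induced map on the tensor
  product is never constructed.\<close>

lemma bilinear_zero_if_pure_tensor_zero:
  fixes R (structure)
  assumes "module R A" "module R B" "module R Y"
    and closed: "\<And>a b. a \<in> carrier A \<Longrightarrow> b \<in> carrier B \<Longrightarrow> \<beta> a b \<in> carrier Y"
    and "\<And>a a' b. a \<in> carrier A \<Longrightarrow> a' \<in> carrier A \<Longrightarrow> b \<in> carrier B \<Longrightarrow>
      \<beta> (a \<oplus>\<^bsub>A\<^esub> a') b = \<beta> a b \<oplus>\<^bsub>Y\<^esub> \<beta> a' b"
    and "\<And>a b b'. a \<in> carrier A \<Longrightarrow> b \<in> carrier B \<Longrightarrow> b' \<in> carrier B \<Longrightarrow>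
      \<beta> a (b \<oplus>\<^bsub>B\<^esub> b') = \<beta> a b \<oplus>\<^bsub>Y\<^esub> \<beta> a b'"
    and "\<And>r a b. r \<in> carrier R \<Longrightarrow> a \<in> carrier A \<Longrightarrow> b \<in> carrier B \<Longrightarrow>
      \<beta> (r \<odot>\<^bsub>A\<^esub> a) b = r \<odot>\<^bsub>Y\<^esub> \<beta> a b"
    and "\<And>r a b. r \<in> carrier R \<Longrightarrow> a \<in> carrier A \<Longrightarrow> b \<in> carrier B \<Longrightarrow>
      \<beta> a (r \<odot>\<^bsub>B\<^esub> b) = r \<odot>\<^bsub>Y\<^esub> \<beta> a b"
    and "a \<in> carrier A" "b \<in> carrier B"
    and zero: "pure_tensor R A B a b = \<zero>\<^bsub>tensor_module R A B\<^esub>"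
  shows "\<beta> a b = \<zero>\<^bsub>Y\<^esub>"
proof -
  interpret A: module R A by fact
  interpret B: module R B by fact
  interpret Y: module R Y by fact
  let ?F = "free_module R (carrier A \<times> carrier B)" and ?K = "tensor_kernel R A B"
  have F: "module R ?F" by (rule module_free_module[OF A.R.is_cring])
  interpret F: module R ?F by (rule F)
  note K = submodule_tensor_kernel[OF assms(1,2)]
  have gen: "free_gen R (a, b) \<in> carrier ?F" if "a \<in> carrier A" "b \<in> carrier B" for a b
    using that by (intro free_gen_closed A.R.is_cring) auto
  obtain \<Phi> where \<Phi>: "\<Phi> \<in> mod_hom R ?F Y"
    and "\<And>i. i \<in> carrier A \<times> carrier B \<Longrightarrow> \<Phi> (free_gen R i) = case_prod \<beta> i"
    by (rule free_module_universal[OF assms(3), of "case_prod \<beta>" "carrier A \<times> carrier B"])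
      (use closed in auto)
  then have \<Phi>_gen: "\<Phi> (free_gen R (a, b)) = \<beta> a b" if "a \<in> carrier A" "b \<in> carrier B" for a b
    using that by auto
  have "tensor_relations R A B \<subseteq> {x \<in> carrier ?F. \<Phi> x = \<zero>\<^bsub>Y\<^esub>}"
  proof -
    have Z: "x \<ominus>\<^bsub>?F\<^esub> y \<in> {x \<in> carrier ?F. \<Phi> x = \<zero>\<^bsub>Y\<^esub>}"
      if "x \<in> carrier ?F" "y \<in> carrier ?F" "\<Phi> x = \<Phi> y" for x y
      using that mod_hom_minus[OF F assms(3) \<Phi>] mod_homD(1)[OF \<Phi>]
      by (simp add: Y.M.minus_eq_zero_iff)
    show ?thesis
      unfolding tensor_relations_def Let_def
      by (intro Un_least subsetI; elim CollectE exE conjE; hypsubst; rule Z)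
        (simp_all add: mod_homD(2,3)[OF \<Phi>] gen \<Phi>_gen assms(4-8))
  qed
  then have "?K \<subseteq> {x \<in> carrier ?F. \<Phi> x = \<zero>\<^bsub>Y\<^esub>}"
    unfolding tensor_kernel_def by (intro mod_span_minimal submodule_kernel F assms \<Phi>)
  moreover have "free_gen R (a, b) \<in> ?K"
    using zero quot_module_coset_eq_self_iff[OF F K] gen assms(9,10)
    by (simp add: pure_tensor_def tensor_module_def quot_module_def)
  ultimately show ?thesis using \<Phi>_gen assms(9,10) by auto
qed

section \<open>Tensoring with a residue ring\<close>

text \<open>This is the isomorphism of R/I \<otimes> Y with Y/IY, stated as exactness. That the
  kernel is no larger than I Y is detected by the bilinear map (a + I, y) |-> a y + I Y, which sends
  (1 + I, y) to the class of y.\<close>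

lemma short_exact_residue_tensor:
  fixes R (structure)
  assumes "module R Y" "ideal I R"
  defines "Q \<equiv> quot_module (ring_as_module R) I"
  shows "short_exact R (ideal_mult_module R I Y) (\<lambda>y. y) Y
    (\<lambda>y. pure_tensor R Q Y (I +>\<^bsub>ring_as_module R\<^esub> \<one>) y) (tensor_module R Q Y)"
proof -
  interpret Y: module R Y by fact
  interpret I: ideal I R by fact
  let ?D = "ring_as_module R" and ?T = "tensor_module R Q Y"
  let ?gens = "{a \<odot>\<^bsub>Y\<^esub> y | a y. a \<in> I \<and> y \<in> carrier Y}"
  let ?X = "mod_span R Y ?gens" and ?e = "I +>\<^bsub>ring_as_module R\<^esub> \<one>"
  have D: "module R ?D" by (rule module_ring_as_module[OF Y.R.is_cring])
  have ID: "submodule I R ?D" by (rule submodule_ideal[OF Y.R.is_cring assms(2)])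
  have Q: "module R Q" unfolding Q_def by (rule module_quot_module[OF D ID])
  have T: "module R ?T" by (rule module_tensor_module[OF Q assms(1)])
  interpret Q: module R Q by (rule Q)
  interpret T: module R ?T by (rule T)
  have D_simps: "carrier ?D = carrier R" "add ?D = add R" "module.smult ?D = monoid.mult R"
    by (simp_all add: ring_as_module_def)
  have Q_carrier: "carrier Q = (\<lambda>a. I +>\<^bsub>?D\<^esub> a) ` carrier R"
    by (simp add: Q_def quot_module_carrier D_simps)
  have e: "?e \<in> carrier Q" by (auto simp: Q_carrier)
  have coset: "I +>\<^bsub>?D\<^esub> a = a \<odot>\<^bsub>Q\<^esub> ?e" if "a \<in> carrier R" for a
    using quot_module_smult[OF D ID, of a \<one>] that by (simp add: Q_def D_simps)
  have gens: "?gens \<subseteq> carrier Y" by auto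
  have X: "submodule ?X R Y" by (rule submodule_mod_span[OF assms(1) gens])
  note t_bilinear = pure_tensor_bilinear[OF Q assms(1)]
  let ?t = "\<lambda>y. pure_tensor R Q Y ?e y"
  have t: "?t \<in> mod_hom R Y ?T"
    using e by (intro mod_homI) (auto simp: t_bilinear intro!: pure_tensor_closed Q assms(1))
  \<comment> \<open>Moving the scalar across, (a + I) \<otimes> y = 1 \<otimes> a y. This yields
    surjectivity, and for a in \<open>I\<close> the vanishing on I Y.\<close>
  have smult_e: "pure_tensor R Q Y (I +>\<^bsub>?D\<^esub> a) y = ?t (a \<odot>\<^bsub>Y\<^esub> y)"
    if "a \<in> carrier R" "y \<in> carrier Y" for a y
    using that e by (simp add: coset[of a] t_bilinear)
  have "?t ` carrier Y = carrier ?T"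
  proof (rule submodule_tensor_module_eq_carrier[OF Q assms(1)])
    show "submodule (?t ` carrier Y) R ?T" by (rule submodule_image[OF assms(1) T t])
    show "pure_tensor R Q Y C y \<in> ?t ` carrier Y" if Cy: "C \<in> carrier Q" "y \<in> carrier Y" for C y
    proof -
      obtain a where "a \<in> carrier R" "C = I +>\<^bsub>?D\<^esub> a"
        using Cy(1) by (auto simp: Q_carrier)
      then show ?thesis using smult_e Cy(2) Y.smult_closed by blast
    qed
  qed
  moreover have "?X = {y \<in> carrier Y. ?t y = \<zero>\<^bsub>?T\<^esub>}"
  proof
    have "?t (a \<odot>\<^bsub>Y\<^esub> y) = \<zero>\<^bsub>?T\<^esub>" if "a \<in> I" "y \<in> carrier Y" for a y
    proof -
      have "?t (a \<odot>\<^bsub>Y\<^esub> y) = pure_tensor R Q Y (I +>\<^bsub>?D\<^esub> a) y"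
        using smult_e[of a y] that I.Icarr by simp
      also have "I +>\<^bsub>?D\<^esub> a = I +>\<^bsub>?D\<^esub> \<zero>"
        using that quot_module_coset_eq_self_iff[OF D ID, of a]
          quot_module_coset_eq_self_iff[OF D ID, of \<zero>]
        by (simp add: D_simps I.Icarr)
      also have "pure_tensor R Q Y (I +>\<^bsub>?D\<^esub> \<zero>) y = \<zero> \<odot>\<^bsub>?T\<^esub> ?t y"
        by (simp only: coset[OF Y.R.zero_closed] t_bilinear(3)[OF Y.R.zero_closed e that(2)])
      also have "\<dots> = \<zero>\<^bsub>?T\<^esub>"
        using that e pure_tensor_closed[OF Q assms(1)] by simp
      finally show ?thesis .
    qed
    then show "?X \<subseteq> {y \<in> carrier Y. ?t y = \<zero>\<^bsub>?T\<^esub>}"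
      by (intro mod_span_minimal submodule_kernel[OF assms(1) T t]) (auto simp: I.Icarr)
    have QX: "module R (quot_module Y ?X)" by (rule module_quot_module[OF assms(1) X])
    \<comment> \<open>Multiplication with values in Y/IY. The union over all representatives
      collapses to a single coset, because changing a by an element of \<open>I\<close> changes a y
      by an element of I Y.\<close>
    define \<beta> where "\<beta> C y = (\<Union>a\<in>C. ?X +>\<^bsub>Y\<^esub> (a \<odot>\<^bsub>Y\<^esub> y))" for C y
    have \<beta>: "\<beta> (I +>\<^bsub>?D\<^esub> a) y = ?X +>\<^bsub>Y\<^esub> (a \<odot>\<^bsub>Y\<^esub> y)"
      if ay: "a \<in> carrier R" "y \<in> carrier Y" for a y
    proof -
      interpret ID: abelian_subgroup I ?D by (rule abelian_subgroup_submodule[OF D ID])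
      have "?X +>\<^bsub>Y\<^esub> (b \<odot>\<^bsub>Y\<^esub> y) = ?X +>\<^bsub>Y\<^esub> (a \<odot>\<^bsub>Y\<^esub> y)" if b: "b \<in> I +>\<^bsub>?D\<^esub> a" for b
      proof -
        obtain i where i: "i \<in> I" "b = i \<oplus> a"
          using b unfolding a_r_coset_def' by (auto simp: D_simps)
        then have "b \<odot>\<^bsub>Y\<^esub> y \<ominus>\<^bsub>Y\<^esub> a \<odot>\<^bsub>Y\<^esub> y = i \<odot>\<^bsub>Y\<^esub> y"
          using ay I.Icarr by (simp add: Y.smult_l_distr a_minus_def Y.M.a_assoc Y.M.r_neg)
        also have "i \<odot>\<^bsub>Y\<^esub> y \<in> ?X"
          using i ay by (intro subsetD[OF mod_span_superset]) auto
        finally show ?thesis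
          using quot_module_coset_eq_iff[OF assms(1) X] i ay I.Icarr by simp
      qed
      moreover have "a \<in> I +>\<^bsub>?D\<^esub> a" using ID.a_rcos_self ay by (simp add: D_simps)
      ultimately show ?thesis unfolding \<beta>_def by blast
    qed
    note \<beta>_simps = \<beta> quot_module_carrier quot_module_add[OF assms(1) X]
      quot_module_smult[OF assms(1) X] Y.smult_l_distr Y.smult_r_distr Y.smult_assoc1
      quot_module_add[OF D ID] quot_module_smult[OF D ID] D_simps
    show "{y \<in> carrier Y. ?t y = \<zero>\<^bsub>?T\<^esub>} \<subseteq> ?X"
    proof safe
      fix y assume y: "y \<in> carrier Y" "?t y = \<zero>\<^bsub>?T\<^esub>"
      have "\<beta> ?e y = \<zero>\<^bsub>quot_module Y ?X\<^esub>"
      proof (rule bilinear_zero_if_pure_tensor_zero[OF Q assms(1) QX _ _ _ _ _ e y])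
        fix r C z assume rCz: "r \<in> carrier R" "C \<in> carrier Q" "z \<in> carrier Y"
        then obtain a where a: "a \<in> carrier R" "C = I +>\<^bsub>?D\<^esub> a" by (auto simp: Q_carrier)
        have "a \<odot>\<^bsub>Y\<^esub> (r \<odot>\<^bsub>Y\<^esub> z) = r \<odot>\<^bsub>Y\<^esub> (a \<odot>\<^bsub>Y\<^esub> z)"
          using rCz a by (simp add: Y.R.m_comm flip: Y.smult_assoc1)
        then show "\<beta> C (r \<odot>\<^bsub>Y\<^esub> z) = r \<odot>\<^bsub>quot_module Y ?X\<^esub> \<beta> C z"
          using rCz a by (simp add: \<beta>_simps)
      qed (auto simp: Q_carrier, auto simp: Q_def \<beta>_simps)
      then have "?X +>\<^bsub>Y\<^esub> y = ?X" using y by (simp add: \<beta> quot_module_def)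
      then show "y \<in> ?X" using quot_module_coset_eq_self_iff[OF assms(1) X] y by simp
    qed
  qed
  moreover have "module R (ideal_mult_module R I Y)"
    unfolding ideal_mult_module_def by (rule submodule.submodule_is_module[OF X assms(1)])
  moreover have "(\<lambda>y. y) \<in> mod_hom R (ideal_mult_module R I Y) Y"
    using Y.submoduleE(1)[OF X] by (intro mod_homI) (auto simp: ideal_mult_module_def)
  ultimately show ?thesis
    using t T assms(1) by (simp add: short_exact_def ideal_mult_module_def)
qed

section \<open>Hilbert's basis theorem\<close>

lemma diff_ring_simps:
  "carrier (diff_ring n) = {p. \<forall>m\<in>Poly_Mapping.keys p. Poly_Mapping.keys m \<subseteq> {1..n}}"
  "p \<otimes>\<^bsub>diff_ring n\<^esub> q = p * q" "p \<oplus>\<^bsub>diff_ring n\<^esub> q = p + q"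
  "\<zero>\<^bsub>diff_ring n\<^esub> = 0" "\<one>\<^bsub>diff_ring n\<^esub> = 1"
  by (simp_all add: diff_ring_def ring_of_type_algebra_def)

lemma single_in_diff_ring:
  "Poly_Mapping.keys t \<subseteq> {1..n} \<Longrightarrow> Poly_Mapping.single t c \<in> carrier (diff_ring n)"
  by (auto simp: diff_ring_simps split: if_splits)

lemma const_poly_in_diff_ring: "const_poly c \<in> carrier (diff_ring n)"
  by (simp add: single_in_diff_ring)

lemma cring_diff_ring: "cring (diff_ring n :: 'k::field mpoly ring)"
proof (intro cringI abelian_groupI comm_monoidI)
  fix p q :: "'k mpoly"
  assume pq: "p \<in> carrier (diff_ring n)" "q \<in> carrier (diff_ring n)"
  show "p \<otimes>\<^bsub>diff_ring n\<^esub> q \<in> carrier (diff_ring n)"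
    unfolding diff_ring_simps mem_Collect_eq
  proof
    fix m assume "m \<in> Poly_Mapping.keys (p * q)"
    then obtain a b where "m = a + b" "a \<in> Poly_Mapping.keys p" "b \<in> Poly_Mapping.keys q"
      using keys_mult[of p q] by blast
    then show "Poly_Mapping.keys m \<subseteq> {1..n}"
      using keys_add[of a b] pq unfolding diff_ring_simps by blast
  qed
  show "p \<oplus>\<^bsub>diff_ring n\<^esub> q \<in> carrier (diff_ring n)"
    using keys_add[of p q] pq unfolding diff_ring_simps by blast
next
  fix p :: "'k mpoly"
  assume "p \<in> carrier (diff_ring n)"
  then show "\<exists>q\<in>carrier (diff_ring n). q \<oplus>\<^bsub>diff_ring n\<^esub> p = \<zero>\<^bsub>diff_ring n\<^esub>"
    by (intro bexI[of _ "- p"]) (auto simp: diff_ring_simps)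
qed (auto simp: diff_ring_simps algebra_simps)

lemma diff_ring_uminus:
  fixes p :: "'k::field mpoly"
  assumes "p \<in> carrier (diff_ring n)" shows "\<ominus>\<^bsub>diff_ring n\<^esub> p = - p"
proof -
  interpret cring "diff_ring n :: 'k mpoly ring" by (rule cring_diff_ring)
  have "- p \<in> carrier (diff_ring n)" using assms by (simp add: diff_ring_simps)
  then show ?thesis using assms minus_equality[of "- p" p] by (simp add: diff_ring_simps)
qed

lemma diff_ring_minus:
  "p \<in> carrier (diff_ring n) \<Longrightarrow> q \<in> carrier (diff_ring n) \<Longrightarrow> p \<ominus>\<^bsub>diff_ring n\<^esub> q = p - q"
  by (simp add: a_minus_def diff_ring_uminus diff_ring_simps)

section \<open>Dickson's lemma and the order on exponents\<close>

text \<open>Every sequence has a monotone subsequence. If that one decreases, it is constant from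
  the index of its minimum on, and this tail counts as increasing.\<close>

lemma incseq_subseq_nat:
  fixes s :: "nat \<Rightarrow> nat"
  obtains r where "strict_mono r" "incseq (s \<circ> r)"
proof -
  obtain r where r: "strict_mono r" "monoseq (\<lambda>i. s (r i))" using seq_monosub[of s] by blast
  show thesis
  proof (cases "incseq (\<lambda>i. s (r i))")
    case True
    then show thesis using that r by (simp add: comp_def)
  next
    case False
    then have dec: "decseq (\<lambda>i. s (r i))" using r(2) by (simp add: monoseq_iff)
    define N where "N = (ARG_MIN (\<lambda>i. s (r i)) i. True)"
    have "s (r N) \<le> s (r i)" for i
      unfolding N_def by (rule arg_min_nat_le) simp
    then have "s (r (i + N)) = s (r N)" for i
      using decseqD[OF dec, of N "i + N"] by (simp add: antisym)
    moreover have "strict_mono (\<lambda>i. r (i + N))"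
      using r(1) by (simp add: strict_mono_def)
    ultimately show thesis using that[of "\<lambda>i. r (i + N)"] by (simp add: comp_def incseq_def)
  qed
qed

text \<open>The coordinates are treated one after another: those already made increasing stay so on
  passing to a further subsequence.\<close>

lemma incseq_subseq_family_nat:
  fixes s :: "'v \<Rightarrow> nat \<Rightarrow> nat"
  assumes "finite V"
  shows "\<exists>r. strict_mono r \<and> (\<forall>v\<in>V. incseq (s v \<circ> r))"
  using assms
proof (induction V)
  case empty
  then show ?case by (auto intro!: exI[of _ id] simp: strict_mono_def)
next
  case (insert v V)
  then obtain r where r: "strict_mono r" "\<forall>v\<in>V. incseq (s v \<circ> r)" by blast
  obtain r' where r': "strict_mono r'" "incseq (s v \<circ> r \<circ> r')" by (rule incseq_subseq_nat)
  have "incseq (s w \<circ> (r \<circ> r'))" if "w \<in> insert v V" for w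
  proof (cases "w = v")
    case False
    then have "incseq (s w \<circ> r)" using r(2) that by simp
    then show ?thesis
      using strict_mono_mono[OF r'(1)] by (auto simp: incseq_def mono_def)
  qed (use r' in \<open>simp add: comp_assoc\<close>)
  then show ?case using strict_mono_o[OF r(1) r'(1)] by blast
qed

text \<open>Dickson's lemma: among infinitely many monomials in finitely many indeterminates, an
  earlier one divides a later one. Along a subsequence with all coordinates increasing, the first
  two entries already serve.\<close>

lemma dickson_sequence:
  fixes t :: "nat \<Rightarrow> (nat \<Rightarrow>\<^sub>0 nat)"
  assumes "finite V" "\<And>i. Poly_Mapping.keys (t i) \<subseteq> V"
  obtains i j u where "i < j" "t j = t i + u" "Poly_Mapping.keys u \<subseteq> V"
proof -
  obtain r where r: "strict_mono r" "\<forall>v\<in>V. incseq ((\<lambda>i. Poly_Mapping.lookup (t i) v) \<circ> r)"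
    using incseq_subseq_family_nat[OF assms(1), of "\<lambda>v i. Poly_Mapping.lookup (t i) v"] by blast
  have le: "Poly_Mapping.lookup (t (r 0)) v \<le> Poly_Mapping.lookup (t (r 1)) v" for v
  proof (cases "v \<in> V")
    case True
    then show ?thesis using r(2) by (auto simp: incseq_def)
  next
    case False
    then have "v \<notin> Poly_Mapping.keys (t (r 0))" using assms(2) by blast
    then show ?thesis by (simp add: in_keys_iff)
  qed
  \<comment> \<open>Subtraction of exponents is truncated; \<open>le\<close> makes it exact in every
    coordinate.\<close>
  have "t (r 1) = t (r 0) + (t (r 1) - t (r 0))"
    by (rule poly_mapping_eqI) (use le in \<open>simp add: lookup_add lookup_minus\<close>)
  moreover have "Poly_Mapping.keys (t (r 1) - t (r 0)) \<subseteq> V"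
    using assms(2)[of "r 1"] by (force simp: in_keys_iff lookup_minus subset_iff)
  moreover have "r 0 < r 1" using r(1) by (simp add: strict_mono_def)
  ultimately show thesis using that by blast
qed

text \<open>Exponents are ordered lexicographically, by the first index at which they differ, and a
  natural number there cannot be below zero.\<close>

lemma poly_mapping_nat_nonneg: "0 \<le> (u :: nat \<Rightarrow>\<^sub>0 nat)"
proof -
  have "\<not> u < 0" by transfer (simp add: less_fun_def)
  then show ?thesis by simp
qed

text \<open>By Dickson's lemma an infinite descending chain would contain some f j = f i + u with i
  < j, yet adding u cannot make an exponent smaller. The finite set \<open>V\<close> is essential:
  the single indeterminates of increasing index form an infinite descending chain.\<close>

lemma wf_exponent_less:
  assumes "finite V"
  shows "wf {(s, t :: nat \<Rightarrow>\<^sub>0 nat). s < t \<and> Poly_Mapping.keys s \<subseteq> V \<and> Poly_Mapping.keys t \<subseteq> V}"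
  unfolding wf_iff_no_infinite_down_chain
proof
  assume "\<exists>f. \<forall>i. (f (Suc i), f i) \<in> {(s, t :: nat \<Rightarrow>\<^sub>0 nat).
    s < t \<and> Poly_Mapping.keys s \<subseteq> V \<and> Poly_Mapping.keys t \<subseteq> V}"
  then obtain f :: "nat \<Rightarrow> (nat \<Rightarrow>\<^sub>0 nat)"
    where f: "\<And>i. f (Suc i) < f i" "\<And>i. Poly_Mapping.keys (f i) \<subseteq> V"
    by auto
  obtain i j u where iju: "i < j" "f j = f i + u" by (rule dickson_sequence[OF assms f(2)])
  have "f j < f i"
    using iju(1) f(1) by (induction rule: less_Suc_induct) (auto intro: less_trans)
  moreover have "f i \<le> f j"
    unfolding iju(2) using add_left_mono[OF poly_mapping_nat_nonneg[of u], of "f i"] by simp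
  ultimately show False by simp
qed

lemma exponent_minimal:
  fixes A :: "(nat \<Rightarrow>\<^sub>0 nat) set"
  assumes "finite V" "A \<noteq> {}" "\<And>t. t \<in> A \<Longrightarrow> Poly_Mapping.keys t \<subseteq> V"
  shows "\<exists>s\<in>A. \<forall>t\<in>A. \<not> t < s"
proof -
  define r where "r = {(s, t :: nat \<Rightarrow>\<^sub>0 nat).
    s < t \<and> Poly_Mapping.keys s \<subseteq> V \<and> Poly_Mapping.keys t \<subseteq> V}"
  have "wf r" unfolding r_def by (rule wf_exponent_less[OF assms(1)])
  moreover obtain t\<^sub>0 where "t\<^sub>0 \<in> A" using assms(2) by blast
  ultimately have "\<exists>s\<in>A. \<forall>t. (t, s) \<in> r \<longrightarrow> t \<notin> A"
    by (simp only: wf_eq_minimal)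
  then obtain s where s: "s \<in> A" "\<forall>t. (t, s) \<in> r \<longrightarrow> t \<notin> A" by blast
  show ?thesis
  proof (rule bexI[OF _ s(1)], intro ballI notI)
    fix t assume "t \<in> A" "t < s"
    then have "(t, s) \<in> r"
      using assms(3)[OF s(1)] assms(3)[OF \<open>t \<in> A\<close>] unfolding r_def by blast
    with s(2) \<open>t \<in> A\<close> show False by blast
  qed
qed

section \<open>Leading terms and the basis theorem\<close>

lemma leading_term_split:
  fixes f :: "'t::linorder \<Rightarrow>\<^sub>0 'k::ab_group_add"
  assumes "f \<noteq> 0"
  defines "s \<equiv> Max (Poly_Mapping.keys f)"
  obtains f' where "f = Poly_Mapping.single s (Poly_Mapping.lookup f s) + f'"
    "\<forall>t\<in>Poly_Mapping.keys f'. t < s"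
proof (rule that)
  let ?f' = "f - Poly_Mapping.single s (Poly_Mapping.lookup f s)"
  show "f = Poly_Mapping.single s (Poly_Mapping.lookup f s) + ?f'" by simp
  show "\<forall>t\<in>Poly_Mapping.keys ?f'. t < s"
  proof
    fix t assume "t \<in> Poly_Mapping.keys ?f'"
    then have "Poly_Mapping.lookup f t \<noteq> 0" "t \<noteq> s"
      by (auto simp: in_keys_iff lookup_minus lookup_single when_def split: if_splits)
    moreover have "t \<le> s" if "Poly_Mapping.lookup f t \<noteq> 0"
      unfolding s_def using that by (intro Max_ge) (auto simp: in_keys_iff)
    ultimately show "t < s" by simp
  qed
qed

text \<open>One division step. The quotient of the leading coefficients cancels the leading term of
  \<open>g\<close>, and the lower terms of \<open>f\<close> stay below it after the shift by
  \<open>u\<close> because the order is compatible with addition.\<close>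

lemma leading_term_reduction:
  fixes f g :: "'k::field mpoly"
  assumes "f \<noteq> 0" "g \<noteq> 0" and lead: "Max (Poly_Mapping.keys g) = Max (Poly_Mapping.keys f) + u"
  obtains c where "\<forall>t\<in>Poly_Mapping.keys (g - Poly_Mapping.single u c * f).
    t < Max (Poly_Mapping.keys g)"
proof -
  let ?s = "Max (Poly_Mapping.keys f)"
  let ?a = "Poly_Mapping.lookup f ?s" and ?b = "Poly_Mapping.lookup g (?s + u)"
  obtain f' where f': "f = Poly_Mapping.single ?s ?a + f'"
    "\<forall>t\<in>Poly_Mapping.keys f'. t < ?s"
    by (rule leading_term_split[OF assms(1)])
  obtain g' where g': "g = Poly_Mapping.single (?s + u) ?b + g'"
    "\<forall>t\<in>Poly_Mapping.keys g'. t < ?s + u"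
    by (rule leading_term_split[OF assms(2), unfolded lead])
  have "?s \<in> Poly_Mapping.keys f" using assms(1) by (intro Max_in) auto
  then have "?a \<noteq> 0" by (simp add: in_keys_iff)
  define c where "c = ?b / ?a"
  have "Poly_Mapping.single u c * f = Poly_Mapping.single u c * (Poly_Mapping.single ?s ?a + f')"
    using f'(1) by simp
  also have "\<dots> = Poly_Mapping.single (?s + u) ?b + Poly_Mapping.single u c * f'"
    using \<open>?a \<noteq> 0\<close> by (simp add: distrib_left mult_single c_def add.commute)
  finally have h: "g - Poly_Mapping.single u c * f = g' - Poly_Mapping.single u c * f'"
    by (subst g'(1)) simp
  show thesis
  proof (rule that, rule ballI)
    fix t assume "t \<in> Poly_Mapping.keys (g - Poly_Mapping.single u c * f)"
    then have "t \<in> Poly_Mapping.keys g' \<union> Poly_Mapping.keys (Poly_Mapping.single u c * f')"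
      unfolding h using keys_add[of g' "- (Poly_Mapping.single u c * f')"] by auto
    then show "t < Max (Poly_Mapping.keys g)"
    proof
      assume "t \<in> Poly_Mapping.keys (Poly_Mapping.single u c * f')"
      then obtain t' where t': "t' \<in> Poly_Mapping.keys f'" "t = u + t'"
        using keys_mult[of "Poly_Mapping.single u c" f'] by (auto split: if_splits)
      then have "u + t' < u + ?s" using f'(2) by (intro add_strict_left_mono) auto
      then show ?thesis using t' lead by (simp add: add.commute)
    qed (use g'(2) lead in simp)
  qed
qed

text \<open>
  If no finite set generated the ideal, one could keep adding an element with minimal leading
  exponent outside the ideal generated so far. By Dickson's lemma the leading exponent of some
  later element is divisible by that of an earlier one, so it could be reduced, contradicting
  minimality.
\<close>

theorem noetherian_ring_diff_ring: "noetherian_ring (diff_ring n :: 'k::field mpoly ring)"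
proof -
  interpret cring "diff_ring n :: 'k mpoly ring" by (rule cring_diff_ring)
  let ?R = "diff_ring n :: 'k mpoly ring"
  let ?lead = "\<lambda>p :: 'k mpoly. Max (Poly_Mapping.keys p)"
  show ?thesis
  proof (rule noetherian_ringI, rule ccontr)
    fix I assume "ideal I ?R" and nfg: "\<not> (\<exists>A\<subseteq>carrier ?R. finite A \<and> I = Idl\<^bsub>?R\<^esub> A)"
    interpret I: ideal I ?R by fact
    have lead_keys: "Poly_Mapping.keys (?lead p) \<subseteq> {1..n}" if "p \<in> I" "p \<noteq> 0" for p
    proof -
      have "?lead p \<in> Poly_Mapping.keys p" using that by (intro Max_in) auto
      moreover have "p \<in> carrier ?R" using that I.Icarr by simp
      ultimately show ?thesis unfolding diff_ring_simps by blast
    qed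
    have Idl: "ideal (Idl\<^bsub>?R\<^esub> F) ?R" "F \<subseteq> Idl\<^bsub>?R\<^esub> F" if "F \<subseteq> I" for F
      using order_trans[OF that I.a_subset] by (rule genideal_ideal, rule genideal_self)
    \<comment> \<open>Zero lies in every generated ideal, so the elements chosen outside are nonzero
      and have a genuine leading exponent.\<close>
    have zero: "0 \<in> Idl\<^bsub>?R\<^esub> F" if "F \<subseteq> I" for F
      using additive_subgroup.zero_closed[OF ideal.axioms(1)[OF Idl(1)[OF that]]]
      by (simp add: diff_ring_simps)
    have "\<exists>p\<in>I - Idl\<^bsub>?R\<^esub> F. \<forall>q\<in>I - Idl\<^bsub>?R\<^esub> F. \<not> ?lead q < ?lead p"
      if F: "finite F" "F \<subseteq> I" for F
    proof -
      have "I \<noteq> Idl\<^bsub>?R\<^esub> F" using nfg F I.a_subset by blast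
      moreover have "Idl\<^bsub>?R\<^esub> F \<subseteq> I" using F \<open>ideal I ?R\<close> by (intro genideal_minimal)
      ultimately have "?lead ` (I - Idl\<^bsub>?R\<^esub> F) \<noteq> {}" by blast
      moreover have "Poly_Mapping.keys (?lead p) \<subseteq> {1..n}" if "p \<in> I - Idl\<^bsub>?R\<^esub> F" for p
        using that zero[OF F(2)] lead_keys[of p] by auto
      ultimately have "\<exists>s\<in>?lead ` (I - Idl\<^bsub>?R\<^esub> F). \<forall>t\<in>?lead ` (I - Idl\<^bsub>?R\<^esub> F). \<not> t < s"
        by (intro exponent_minimal[of "{1..n}"]) auto
      then show ?thesis by simp
    qed
    then obtain P where P: "\<And>F. finite F \<Longrightarrow> F \<subseteq> I \<Longrightarrow> P F \<in> I - Idl\<^bsub>?R\<^esub> F"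
      "\<And>F q. finite F \<Longrightarrow> F \<subseteq> I \<Longrightarrow> q \<in> I - Idl\<^bsub>?R\<^esub> F \<Longrightarrow> \<not> ?lead q < ?lead (P F)"
      by metis
    \<comment> \<open>\<open>F k\<close> holds the elements chosen in the first k rounds, and
      \<open>P (F k)\<close> is the next one.\<close>
    define F where "F = rec_nat {} (\<lambda>_ F. insert (P F) F)"
    have F: "finite (F k)" "F k \<subseteq> I" for k
      by (induction k) (use P(1) in \<open>auto simp: F_def\<close>)
    have F_mono: "P (F i) \<in> F j" if "i < j" for i j
      using that by (induction j) (auto simp: F_def less_Suc_eq)
    have PF: "P (F k) \<in> I" "P (F k) \<notin> Idl\<^bsub>?R\<^esub> (F k)" "P (F k) \<noteq> 0" for k
      using P(1)[OF F, of k] zero[OF F(2), of k] by (simp, simp, metis DiffD2)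
    obtain i j u where iju: "i < j" "?lead (P (F j)) = ?lead (P (F i)) + u"
      "Poly_Mapping.keys u \<subseteq> {1..n}"
      by (rule dickson_sequence[of "{1..n}" "\<lambda>k. ?lead (P (F k))"]) (use lead_keys PF in auto)
    let ?g = "P (F j)" and ?f = "P (F i)"
    obtain c where c: "\<forall>t\<in>Poly_Mapping.keys (?g - Poly_Mapping.single u c * ?f). t < ?lead ?g"
      by (rule leading_term_reduction[OF PF(3) PF(3) iju(2)])
    let ?h = "?g - Poly_Mapping.single u c * ?f"
    have m: "Poly_Mapping.single u c \<in> carrier ?R" using iju(3) by (rule single_in_diff_ring)
    interpret J: ideal "Idl\<^bsub>?R\<^esub> (F j)" ?R by (rule Idl(1)[OF F(2)])
    have cf: "Poly_Mapping.single u c * ?f \<in> Idl\<^bsub>?R\<^esub> (F j)"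
      using J.I_l_closed[OF _ m] F_mono[OF iju(1)] Idl(2)[OF F(2)[of j]] by (auto simp: diff_ring_simps)
    have cfI: "Poly_Mapping.single u c * ?f \<in> I"
      using I.I_l_closed[OF PF(1) m] by (simp add: diff_ring_simps)
    have "?h = ?g \<ominus>\<^bsub>?R\<^esub> Poly_Mapping.single u c * ?f"
      using cfI PF(1) I.Icarr by (simp add: diff_ring_minus)
    then have "?h \<in> I" using PF(1) cfI by (simp add: a_minus_def)
    \<comment> \<open>Since i < j, the element ?f was adjoined before round j. If ?h belonged to the
      ideal generated so far, adding the multiple of ?f back would put ?g there too.\<close>
    moreover have "?h \<notin> Idl\<^bsub>?R\<^esub> (F j)"
    proof
      assume "?h \<in> Idl\<^bsub>?R\<^esub> (F j)"
      from J.a_closed[OF this cf] show False using PF(2)[of j] by (simp add: diff_ring_simps)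
    qed
    ultimately have h: "?h \<in> I - Idl\<^bsub>?R\<^esub> (F j)" by simp
    then have "?h \<noteq> 0" using zero[OF F(2)] by auto
    then have "?lead ?h \<in> Poly_Mapping.keys ?h" by (intro Max_in) auto
    then show False using c P(2)[OF F h] by blast
  qed
qed

section \<open>Duals\<close>

context
  fixes n :: nat and M :: "('k::field mpoly, 'a, 'y) module_scheme"
  assumes module_M: "module (diff_ring n) M"
begin

interpretation M: module "diff_ring n" M by (rule module_M)

lemma smult_const_closed: "x \<in> carrier M \<Longrightarrow> const_poly c \<odot>\<^bsub>M\<^esub> x \<in> carrier M"
  by (simp add: const_poly_in_diff_ring)

lemma smult_const_add_left:
  "x \<in> carrier M \<Longrightarrow> const_poly (c + d) \<odot>\<^bsub>M\<^esub> x = const_poly c \<odot>\<^bsub>M\<^esub> x \<oplus>\<^bsub>M\<^esub> const_poly d \<odot>\<^bsub>M\<^esub> x"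
  using M.smult_l_distr[OF const_poly_in_diff_ring const_poly_in_diff_ring, of x c d]
  by (simp add: diff_ring_simps single_add)

lemma smult_const_add_right:
  "x \<in> carrier M \<Longrightarrow> y \<in> carrier M \<Longrightarrow>
    const_poly c \<odot>\<^bsub>M\<^esub> (x \<oplus>\<^bsub>M\<^esub> y) = const_poly c \<odot>\<^bsub>M\<^esub> x \<oplus>\<^bsub>M\<^esub> const_poly c \<odot>\<^bsub>M\<^esub> y"
  by (rule M.smult_r_distr[OF const_poly_in_diff_ring])

lemma smult_const_mult:
  "x \<in> carrier M \<Longrightarrow> const_poly c \<odot>\<^bsub>M\<^esub> (const_poly d \<odot>\<^bsub>M\<^esub> x) = const_poly (c * d) \<odot>\<^bsub>M\<^esub> x"
  using M.smult_assoc1[OF const_poly_in_diff_ring const_poly_in_diff_ring, of x c d]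
  by (simp add: diff_ring_simps mult_single)

lemma smult_const_one: "x \<in> carrier M \<Longrightarrow> const_poly 1 \<odot>\<^bsub>M\<^esub> x = x"
  using M.smult_one[of x] by (simp add: diff_ring_simps)

lemma smult_const_zero: "x \<in> carrier M \<Longrightarrow> const_poly 0 \<odot>\<^bsub>M\<^esub> x = \<zero>\<^bsub>M\<^esub>"
  using M.smult_l_null[of x] by (simp add: diff_ring_simps)

lemma smult_const_uminus:
  assumes "x \<in> carrier M" shows "const_poly (- c) \<odot>\<^bsub>M\<^esub> x = \<ominus>\<^bsub>M\<^esub> (const_poly c \<odot>\<^bsub>M\<^esub> x)"
proof -
  have "const_poly (- c) \<odot>\<^bsub>M\<^esub> x \<oplus>\<^bsub>M\<^esub> const_poly c \<odot>\<^bsub>M\<^esub> x = \<zero>\<^bsub>M\<^esub>"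
    using smult_const_add_left[OF assms, of "- c" c] smult_const_zero[OF assms] by simp
  then show ?thesis using assms smult_const_closed M.M.minus_equality by metis
qed

lemma smult_const_commute:
  assumes "p \<in> carrier (diff_ring n)" "x \<in> carrier M"
  shows "p \<odot>\<^bsub>M\<^esub> (const_poly c \<odot>\<^bsub>M\<^esub> x) = const_poly c \<odot>\<^bsub>M\<^esub> (p \<odot>\<^bsub>M\<^esub> x)"
  using M.smult_assoc1[OF assms(1) const_poly_in_diff_ring assms(2), of c]
    M.smult_assoc1[OF const_poly_in_diff_ring assms, of c]
  by (simp add: diff_ring_simps mult.commute)

section \<open>The dual module\<close>

lemma dualI:
  assumes "\<And>x y. x \<in> carrier M \<Longrightarrow> y \<in> carrier M \<Longrightarrow> f (x \<oplus>\<^bsub>M\<^esub> y) = f x + f y"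
    and "\<And>c x. x \<in> carrier M \<Longrightarrow> f (const_poly c \<odot>\<^bsub>M\<^esub> x) = c * f x"
  shows "(\<lambda>x\<in>carrier M. f x) \<in> carrier (dual M)"
  using assms smult_const_closed by (auto simp: dual_def)

lemma dual_add: "f \<in> carrier (dual M) \<Longrightarrow> x \<in> carrier M \<Longrightarrow> y \<in> carrier M \<Longrightarrow>
    f (x \<oplus>\<^bsub>M\<^esub> y) = f x + f y"
  and dual_const: "f \<in> carrier (dual M) \<Longrightarrow> x \<in> carrier M \<Longrightarrow> f (const_poly c \<odot>\<^bsub>M\<^esub> x) = c * f x"
  and dual_eqI: "f \<in> carrier (dual M) \<Longrightarrow> g \<in> carrier (dual M) \<Longrightarrow>
    (\<And>x. x \<in> carrier M \<Longrightarrow> f x = g x) \<Longrightarrow> f = g"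
  by (auto simp: dual_def intro: extensionalityI)

lemma dual_ops:
  "x \<in> carrier M \<Longrightarrow> (f \<oplus>\<^bsub>dual M\<^esub> g) x = f x + g x"
  "x \<in> carrier M \<Longrightarrow> (p \<odot>\<^bsub>dual M\<^esub> f) x = f (p \<odot>\<^bsub>M\<^esub> x)"
  "x \<in> carrier M \<Longrightarrow> \<zero>\<^bsub>dual M\<^esub> x = 0"
  by (simp_all add: dual_def)

lemma dual_zero:
  assumes "f \<in> carrier (dual M)" shows "f \<zero>\<^bsub>M\<^esub> = 0"
  using dual_const[OF assms M.M.zero_closed, of 0] smult_const_zero[OF M.M.zero_closed] by simp

lemma dual_uminus:
  assumes "f \<in> carrier (dual M)" "x \<in> carrier M" shows "f (\<ominus>\<^bsub>M\<^esub> x) = - f x"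
  using dual_const[OF assms, of "- 1"] smult_const_uminus[OF assms(2), of 1]
    smult_const_one[OF assms(2)] by simp

lemma dual_minus:
  assumes "f \<in> carrier (dual M)" "x \<in> carrier M" "y \<in> carrier M"
  shows "f (x \<ominus>\<^bsub>M\<^esub> y) = f x - f y"
  using assms by (simp add: a_minus_def dual_add dual_uminus)

lemma dual_closed:
  shows "\<zero>\<^bsub>dual M\<^esub> \<in> carrier (dual M)"
    and "f \<in> carrier (dual M) \<Longrightarrow> g \<in> carrier (dual M) \<Longrightarrow> f \<oplus>\<^bsub>dual M\<^esub> g \<in> carrier (dual M)"
    and "p \<in> carrier (diff_ring n) \<Longrightarrow> f \<in> carrier (dual M) \<Longrightarrow> p \<odot>\<^bsub>dual M\<^esub> f \<in> carrier (dual M)"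
proof -
  show "\<zero>\<^bsub>dual M\<^esub> \<in> carrier (dual M)"
    using dualI[of "\<lambda>_. 0"] by (simp add: dual_def)
  show "f \<oplus>\<^bsub>dual M\<^esub> g \<in> carrier (dual M)" if "f \<in> carrier (dual M)" "g \<in> carrier (dual M)"
    using dualI[of "\<lambda>x. f x + g x"] that
    by (simp add: dual_add dual_const distrib_left) (simp add: dual_def)
  show "p \<odot>\<^bsub>dual M\<^esub> f \<in> carrier (dual M)"
    if "p \<in> carrier (diff_ring n)" "f \<in> carrier (dual M)"
    using dualI[of "\<lambda>x. f (p \<odot>\<^bsub>M\<^esub> x)"] that
    by (simp add: dual_add dual_const M.smult_r_distr smult_const_commute) (simp add: dual_def)
qed

lemma module_dual: "module (diff_ring n) (dual M)"
proof (intro moduleI abelian_groupI)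
  fix f assume f: "f \<in> carrier (dual M)"
  show "\<exists>g\<in>carrier (dual M). g \<oplus>\<^bsub>dual M\<^esub> f = \<zero>\<^bsub>dual M\<^esub>"
  proof (rule bexI[of _ "const_poly (- 1) \<odot>\<^bsub>dual M\<^esub> f"])
    show g: "const_poly (- 1) \<odot>\<^bsub>dual M\<^esub> f \<in> carrier (dual M)"
      by (rule dual_closed(3)[OF const_poly_in_diff_ring f])
    show "const_poly (- 1) \<odot>\<^bsub>dual M\<^esub> f \<oplus>\<^bsub>dual M\<^esub> f = \<zero>\<^bsub>dual M\<^esub>"
      by (rule dual_eqI) (simp_all add: f g dual_closed dual_ops dual_const)
  qed
  show "\<one>\<^bsub>diff_ring n\<^esub> \<odot>\<^bsub>dual M\<^esub> f = f"
    by (rule dual_eqI) (simp_all add: f dual_closed dual_ops)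
  show "\<zero>\<^bsub>dual M\<^esub> \<oplus>\<^bsub>dual M\<^esub> f = f"
    by (rule dual_eqI) (simp_all add: f dual_closed dual_ops)
next
  fix p q :: "'k mpoly" and f assume pq: "p \<in> carrier (diff_ring n)" "q \<in> carrier (diff_ring n)"
    and f: "f \<in> carrier (dual M)"
  show "(p \<oplus>\<^bsub>diff_ring n\<^esub> q) \<odot>\<^bsub>dual M\<^esub> f = p \<odot>\<^bsub>dual M\<^esub> f \<oplus>\<^bsub>dual M\<^esub> q \<odot>\<^bsub>dual M\<^esub> f"
    by (rule dual_eqI) (simp_all add: pq f dual_closed dual_ops M.smult_l_distr dual_add)
  \<comment> \<open>Acting by precomposition reverses the order of products; commutativity of the
    ring makes it a left action nevertheless.\<close>
  have "p \<otimes>\<^bsub>diff_ring n\<^esub> q = q \<otimes>\<^bsub>diff_ring n\<^esub> p" using pq by (rule M.R.m_comm)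
  then show "p \<otimes>\<^bsub>diff_ring n\<^esub> q \<odot>\<^bsub>dual M\<^esub> f = p \<odot>\<^bsub>dual M\<^esub> (q \<odot>\<^bsub>dual M\<^esub> f)"
    using pq by (intro dual_eqI) (simp_all add: f dual_closed dual_ops M.smult_assoc1)
next
  fix f g h
  assume fgh: "f \<in> carrier (dual M)" "g \<in> carrier (dual M)" "h \<in> carrier (dual M)"
  show "f \<oplus>\<^bsub>dual M\<^esub> g \<oplus>\<^bsub>dual M\<^esub> h = f \<oplus>\<^bsub>dual M\<^esub> (g \<oplus>\<^bsub>dual M\<^esub> h)"
    by (rule dual_eqI) (simp_all add: fgh dual_closed dual_ops)
next
  fix f g assume fg: "f \<in> carrier (dual M)" "g \<in> carrier (dual M)"
  show "f \<oplus>\<^bsub>dual M\<^esub> g = g \<oplus>\<^bsub>dual M\<^esub> f"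
    by (rule dual_eqI) (simp_all add: fg dual_closed dual_ops)
  fix p :: "'k mpoly" assume p: "p \<in> carrier (diff_ring n)"
  show "p \<odot>\<^bsub>dual M\<^esub> (f \<oplus>\<^bsub>dual M\<^esub> g) = p \<odot>\<^bsub>dual M\<^esub> f \<oplus>\<^bsub>dual M\<^esub> p \<odot>\<^bsub>dual M\<^esub> g"
    by (rule dual_eqI) (simp_all add: fg p dual_closed dual_ops)
qed (simp_all add: dual_closed M.R.is_cring)

section \<open>Extension of functionals and the kernel criterion\<close>

text \<open>Zorn's lemma is applied to the graphs of linear extensions of \<open>h\<close>.\<close>

lemma dual_extension:
  assumes W: "W \<subseteq> carrier M" "\<zero>\<^bsub>M\<^esub> \<in> W" "\<And>x y. x \<in> W \<Longrightarrow> y \<in> W \<Longrightarrow> x \<oplus>\<^bsub>M\<^esub> y \<in> W"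
      "\<And>c x. x \<in> W \<Longrightarrow> const_poly c \<odot>\<^bsub>M\<^esub> x \<in> W"
    and h: "\<And>x y. x \<in> W \<Longrightarrow> y \<in> W \<Longrightarrow> h (x \<oplus>\<^bsub>M\<^esub> y) = h x + h y"
      "\<And>c x. x \<in> W \<Longrightarrow> h (const_poly c \<odot>\<^bsub>M\<^esub> x) = c * h x"
  obtains f where "f \<in> carrier (dual M)" "\<And>x. x \<in> W \<Longrightarrow> f x = h x"
proof -
  \<comment> \<open>For a relation closed under sums and scalars, being single-valued reduces to
    zero having no value other than 0. All clauses pass to unions of chains.\<close>
  define lin where "lin G \<longleftrightarrow> G \<subseteq> carrier M \<times> UNIV \<and>
    (\<forall>x a y b. (x, a) \<in> G \<longrightarrow> (y, b) \<in> G \<longrightarrow> (x \<oplus>\<^bsub>M\<^esub> y, a + b) \<in> G) \<and>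
    (\<forall>x a c. (x, a) \<in> G \<longrightarrow> (const_poly c \<odot>\<^bsub>M\<^esub> x, c * a) \<in> G) \<and>
    (\<forall>a. (\<zero>\<^bsub>M\<^esub>, a) \<in> G \<longrightarrow> a = 0)" for G :: "('a \<times> 'k) set"
  define H where "H = (\<lambda>x. (x, h x)) ` W"
  define \<E> where "\<E> = {G. H \<subseteq> G \<and> lin G}"
  have "h \<zero>\<^bsub>M\<^esub> = 0"
    using h(2)[OF W(2), of 0] smult_const_zero[OF M.M.zero_closed] by simp
  then have "H \<in> \<E>"
    using W h unfolding \<E>_def H_def lin_def by auto
  have "\<exists>G\<in>\<E>. \<forall>U\<in>\<E>. G \<subseteq> U \<longrightarrow> U = G"
  proof (rule subset_Zorn_nonempty)
    show "\<E> \<noteq> {}" using \<open>H \<in> \<E>\<close> by blast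
    fix C assume C: "C \<noteq> {}" "subset.chain \<E> C"
    then have C\<E>: "\<And>U. U \<in> C \<Longrightarrow> H \<subseteq> U \<and> lin U"
      and chain: "\<And>U Y. U \<in> C \<Longrightarrow> Y \<in> C \<Longrightarrow> U \<subseteq> Y \<or> Y \<subseteq> U"
      unfolding subset_chain_def \<E>_def by blast+
    have "(x \<oplus>\<^bsub>M\<^esub> y, a + b) \<in> \<Union>C" if xa: "(x, a) \<in> \<Union>C" and yb: "(y, b) \<in> \<Union>C" for x a y b
    proof -
      obtain U Y where XY: "U \<in> C" "(x, a) \<in> U" "Y \<in> C" "(y, b) \<in> Y" using xa yb by blast
      then obtain Z where Z: "Z \<in> C" "(x, a) \<in> Z" "(y, b) \<in> Z" using chain[of U Y] by blast
      then have "(x \<oplus>\<^bsub>M\<^esub> y, a + b) \<in> Z" using C\<E>[OF Z(1)] unfolding lin_def by blast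
      then show ?thesis using Z(1) by blast
    qed
    moreover have "\<Union>C \<subseteq> carrier M \<times> UNIV" "H \<subseteq> \<Union>C"
      using C\<E> C(1) unfolding lin_def by blast+
    moreover have "(const_poly c \<odot>\<^bsub>M\<^esub> x, c * a) \<in> \<Union>C" if "(x, a) \<in> \<Union>C" for x a c
      using that C\<E> unfolding lin_def by blast
    moreover have "a = 0" if "(\<zero>\<^bsub>M\<^esub>, a) \<in> \<Union>C" for a
      using that C\<E> unfolding lin_def by blast
    ultimately show "\<Union>C \<in> \<E>" unfolding \<E>_def lin_def by blast
  qed
  then obtain G where "G \<in> \<E>" and max: "\<And>U. U \<in> \<E> \<Longrightarrow> G \<subseteq> U \<Longrightarrow> U = G" by blast
  then have HG: "H \<subseteq> G" and G: "G \<subseteq> carrier M \<times> UNIV"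
    "\<And>x a y b. (x, a) \<in> G \<Longrightarrow> (y, b) \<in> G \<Longrightarrow> (x \<oplus>\<^bsub>M\<^esub> y, a + b) \<in> G"
    "\<And>x a c. (x, a) \<in> G \<Longrightarrow> (const_poly c \<odot>\<^bsub>M\<^esub> x, c * a) \<in> G"
    "\<And>a. (\<zero>\<^bsub>M\<^esub>, a) \<in> G \<Longrightarrow> a = 0"
    unfolding \<E>_def lin_def by blast+
  have total: "\<exists>a. (x, a) \<in> G" if x: "x \<in> carrier M" for x
  proof (rule ccontr)
    assume nx: "\<nexists>a. (x, a) \<in> G"
    \<comment> \<open>The candidate extends G to the span of its domain and x by giving x the value
      0.\<close>
    define G' where "G' = {(y \<oplus>\<^bsub>M\<^esub> const_poly c \<odot>\<^bsub>M\<^esub> x, a) | y c a. (y, a) \<in> G}"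
    have Gc: "y \<in> carrier M" if "(y, a) \<in> G" for y a using G(1) that by blast
    have "G \<subseteq> G'"
    proof
      fix z assume "z \<in> G"
      then obtain y a where "z = (y, a)" "(y, a) \<in> G" by (cases z) blast
      moreover have "y = y \<oplus>\<^bsub>M\<^esub> const_poly 0 \<odot>\<^bsub>M\<^esub> x"
        using Gc[OF \<open>(y, a) \<in> G\<close>] x smult_const_zero by simp
      ultimately show "z \<in> G'" unfolding G'_def by blast
    qed
    moreover have "lin G'"
      unfolding lin_def
    proof (intro conjI allI impI)
      show "G' \<subseteq> carrier M \<times> UNIV"
        using Gc x smult_const_closed by (auto simp: G'_def)
    next
      fix u a v b assume "(u, a) \<in> G'" "(v, b) \<in> G'"
      then obtain y c z d where yz: "u = y \<oplus>\<^bsub>M\<^esub> const_poly c \<odot>\<^bsub>M\<^esub> x" "(y, a) \<in> G"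
        "v = z \<oplus>\<^bsub>M\<^esub> const_poly d \<odot>\<^bsub>M\<^esub> x" "(z, b) \<in> G"
        by (auto simp: G'_def)
      have "u \<oplus>\<^bsub>M\<^esub> v = (y \<oplus>\<^bsub>M\<^esub> z) \<oplus>\<^bsub>M\<^esub> const_poly (c + d) \<odot>\<^bsub>M\<^esub> x"
        using Gc[OF yz(2)] Gc[OF yz(4)] x smult_const_closed[OF x]
        by (simp add: yz smult_const_add_left M.M.a_ac)
      then show "(u \<oplus>\<^bsub>M\<^esub> v, a + b) \<in> G'" using G(2)[OF yz(2,4)] unfolding G'_def by blast
    next
      fix u a c assume "(u, a) \<in> G'"
      then obtain y d where y: "u = y \<oplus>\<^bsub>M\<^esub> const_poly d \<odot>\<^bsub>M\<^esub> x" "(y, a) \<in> G"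
        by (auto simp: G'_def)
      have "const_poly c \<odot>\<^bsub>M\<^esub> u = const_poly c \<odot>\<^bsub>M\<^esub> y \<oplus>\<^bsub>M\<^esub> const_poly (c * d) \<odot>\<^bsub>M\<^esub> x"
        using Gc[OF y(2)] x smult_const_closed[OF x]
        by (simp add: y smult_const_add_right smult_const_mult)
      then show "(const_poly c \<odot>\<^bsub>M\<^esub> u, c * a) \<in> G'" using G(3)[OF y(2)] unfolding G'_def by blast
    next
      fix a assume "(\<zero>\<^bsub>M\<^esub>, a) \<in> G'"
      then obtain y c where y: "\<zero>\<^bsub>M\<^esub> = y \<oplus>\<^bsub>M\<^esub> const_poly c \<odot>\<^bsub>M\<^esub> x" "(y, a) \<in> G"
        by (auto simp: G'_def)
      note y1 = y(1)[symmetric]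
      have yc: "y \<in> carrier M" using Gc y(2) by blast
      show "a = 0"
      proof (cases "c = 0")
        case True
        then have "y = \<zero>\<^bsub>M\<^esub>" using y1 yc smult_const_zero[OF x] by simp
        then show ?thesis using y(2) G(4) by blast
      next
        case False
        \<comment> \<open>With c nonzero, x is a multiple of y and would already lie in the domain
          of G.\<close>
        have "y = \<ominus>\<^bsub>M\<^esub> (const_poly c \<odot>\<^bsub>M\<^esub> x)"
          using y1 yc smult_const_closed[OF x] M.M.minus_equality[of y] by simp
        then have "y = const_poly (- c) \<odot>\<^bsub>M\<^esub> x" using smult_const_uminus[OF x] by simp
        then have "const_poly (- 1 / c) \<odot>\<^bsub>M\<^esub> y = x"
          using False x smult_const_one[OF x] by (simp add: smult_const_mult)
        then show ?thesis using G(3)[OF y(2), of "- 1 / c"] nx by metis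
      qed
    qed
    ultimately have "G' = G" using HG by (intro max) (auto simp: \<E>_def)
    moreover have "(x, 0) \<in> G'"
    proof -
      have "(\<zero>\<^bsub>M\<^esub>, 0) \<in> G" using HG W(2) \<open>h \<zero>\<^bsub>M\<^esub> = 0\<close> by (force simp: H_def)
      moreover have "x = \<zero>\<^bsub>M\<^esub> \<oplus>\<^bsub>M\<^esub> const_poly 1 \<odot>\<^bsub>M\<^esub> x"
        using x smult_const_one[OF x] M.M.l_zero by simp
      ultimately show ?thesis unfolding G'_def by blast
    qed
    ultimately show False using nx by blast
  qed
  have unique: "a = b" if xa: "(x, a) \<in> G" "(x, b) \<in> G" for x a b
  proof -
    have "x \<in> carrier M" using G(1) xa(1) by blast
    then have "x \<oplus>\<^bsub>M\<^esub> const_poly (- 1) \<odot>\<^bsub>M\<^esub> x = \<zero>\<^bsub>M\<^esub>"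
      using smult_const_uminus[of x 1] smult_const_one[of x] M.M.r_neg by simp
    then have "(\<zero>\<^bsub>M\<^esub>, a - b) \<in> G" using G(2)[OF xa(1) G(3)[OF xa(2), of "- 1"]] by simp
    then have "a - b = 0" by (rule G(4))
    then show ?thesis by simp
  qed
  define f where "f x = (THE a. (x, a) \<in> G)" for x
  have f: "(x, f x) \<in> G" if "x \<in> carrier M" for x
    unfolding f_def using total[OF that] unique by (metis theI)
  have f_eq: "f x = a" if "(x, a) \<in> G" for x a
    unfolding f_def using that unique by blast
  have "(\<lambda>x\<in>carrier M. f x) \<in> carrier (dual M)"
    using G(2,3) f by (intro dualI f_eq) blast+
  moreover have "(\<lambda>x\<in>carrier M. f x) x = h x" if "x \<in> W" for x
  proof -
    have "(x, h x) \<in> G" using HG that by (auto simp: H_def)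
    then show ?thesis using f_eq W(1) that by auto
  qed
  ultimately show thesis using that by blast
qed

text \<open>
  Induction over the annihilating elements: \<open>f\<close> factors on the common kernel \<open>K\<close> of the
  others through multiplication by \<open>a\<close>, and an extension \<open>g\<close> of the factor makes
  \<open>f - a g\<close> vanish on \<open>K\<close>.
\<close>

lemma dual_vanishing_mem:
  assumes "finite A" "A \<subseteq> carrier (diff_ring n)" "submodule H (diff_ring n) (dual M)"
    and "\<And>a g. a \<in> A \<Longrightarrow> g \<in> carrier (dual M) \<Longrightarrow> a \<odot>\<^bsub>dual M\<^esub> g \<in> H"
    and "f \<in> carrier (dual M)"
    and "\<And>x. x \<in> carrier M \<Longrightarrow> (\<And>a. a \<in> A \<Longrightarrow> a \<odot>\<^bsub>M\<^esub> x = \<zero>\<^bsub>M\<^esub>) \<Longrightarrow> f x = 0"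
  shows "f \<in> H"
  using assms(1,2,4-6)
proof (induction A arbitrary: f)
  case empty
  interpret D: module "diff_ring n" "dual M" by (rule module_dual)
  \<comment> \<open>The common kernel of the empty family is all of M, so the functional vanishes
    everywhere.\<close>
  have "f = \<zero>\<^bsub>dual M\<^esub>"
    using empty by (intro dual_eqI dual_closed) (auto simp: dual_ops)
  then show ?case using assms(3) unfolding submodule_iff[OF module_dual] by simp
next
  case (insert a A)
  interpret D: module "diff_ring n" "dual M" by (rule module_dual)
  define K where "K = {x \<in> carrier M. \<forall>b\<in>A. b \<odot>\<^bsub>M\<^esub> x = \<zero>\<^bsub>M\<^esub>}"
  have a: "a \<in> carrier (diff_ring n)" and A: "A \<subseteq> carrier (diff_ring n)" using insert.prems by auto
  have K: "submodule K (diff_ring n) M"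
  proof -
    have "b \<odot>\<^bsub>M\<^esub> (p \<odot>\<^bsub>M\<^esub> x) = \<zero>\<^bsub>M\<^esub>"
      if "b \<in> carrier (diff_ring n)" "p \<in> carrier (diff_ring n)" "x \<in> carrier M"
        "b \<odot>\<^bsub>M\<^esub> x = \<zero>\<^bsub>M\<^esub>" for b p x
      using that M.smult_assoc1[of b p x] M.smult_assoc1[of p b x] M.R.m_comm[of b p] by simp
    then show ?thesis
      using A unfolding submodule_iff[OF module_M] K_def
      by (auto simp: M.smult_r_distr subset_iff)
  qed
  have Kc: "K \<subseteq> carrier M" by (auto simp: K_def)
  define h where "h w = f (SOME x. x \<in> K \<and> a \<odot>\<^bsub>M\<^esub> x = w)" for w
  \<comment> \<open>The chosen preimage does not matter: two of them in K differ by an element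
    killed by \<open>a\<close> as well as by A, and f vanishes on such elements.\<close>
  have h: "h (a \<odot>\<^bsub>M\<^esub> x) = f x" if x: "x \<in> K" for x
  proof -
    define x' where "x' = (SOME x'. x' \<in> K \<and> a \<odot>\<^bsub>M\<^esub> x' = a \<odot>\<^bsub>M\<^esub> x)"
    have x': "x' \<in> K" "a \<odot>\<^bsub>M\<^esub> x' = a \<odot>\<^bsub>M\<^esub> x"
      unfolding x'_def using someI[of "\<lambda>x'. x' \<in> K \<and> a \<odot>\<^bsub>M\<^esub> x' = a \<odot>\<^bsub>M\<^esub> x" x] x by auto
    have xc: "x \<in> carrier M" "x' \<in> carrier M" using x x' Kc by auto
    have "a \<odot>\<^bsub>M\<^esub> (x' \<ominus>\<^bsub>M\<^esub> x) = \<zero>\<^bsub>M\<^esub>"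
      using a xc x'(2) by (simp add: a_minus_def M.smult_r_distr M.smult_r_minus M.M.r_neg)
    moreover have "x' \<ominus>\<^bsub>M\<^esub> x \<in> K" by (rule submodule_minus[OF module_M K x'(1) x])
    ultimately have "f (x' \<ominus>\<^bsub>M\<^esub> x) = 0"
      using xc by (intro insert.prems) (auto simp: K_def)
    then show ?thesis
      using dual_minus[OF insert.prems(3) xc(2,1)] by (simp add: h_def x'_def)
  qed
  obtain g where g: "g \<in> carrier (dual M)" "\<And>w. w \<in> (\<lambda>x. a \<odot>\<^bsub>M\<^esub> x) ` K \<Longrightarrow> g w = h w"
  proof (rule dual_extension[of "(\<lambda>x. a \<odot>\<^bsub>M\<^esub> x) ` K" h])
    note K' = K[unfolded submodule_iff[OF module_M]]
    show "(\<lambda>x. a \<odot>\<^bsub>M\<^esub> x) ` K \<subseteq> carrier M" using a Kc by auto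
    show "\<zero>\<^bsub>M\<^esub> \<in> (\<lambda>x. a \<odot>\<^bsub>M\<^esub> x) ` K"
      using K' a by (metis M.smult_r_null imageI)
  next
    fix u v assume "u \<in> (\<lambda>x. a \<odot>\<^bsub>M\<^esub> x) ` K" "v \<in> (\<lambda>x. a \<odot>\<^bsub>M\<^esub> x) ` K"
    then obtain x y where xy: "x \<in> K" "y \<in> K" "u = a \<odot>\<^bsub>M\<^esub> x" "v = a \<odot>\<^bsub>M\<^esub> y" by blast
    have xyK: "x \<oplus>\<^bsub>M\<^esub> y \<in> K" using K xy unfolding submodule_iff[OF module_M] by blast
    have xyc: "x \<in> carrier M" "y \<in> carrier M" using xy Kc by auto
    have uv: "u \<oplus>\<^bsub>M\<^esub> v = a \<odot>\<^bsub>M\<^esub> (x \<oplus>\<^bsub>M\<^esub> y)"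
      using xyc a by (simp add: xy M.smult_r_distr)
    show "u \<oplus>\<^bsub>M\<^esub> v \<in> (\<lambda>x. a \<odot>\<^bsub>M\<^esub> x) ` K" unfolding uv using xyK by blast
    show "h (u \<oplus>\<^bsub>M\<^esub> v) = h u + h v"
      unfolding uv using h xy xyK dual_add[OF insert.prems(3) xyc] by simp
  next
    fix c u assume "u \<in> (\<lambda>x. a \<odot>\<^bsub>M\<^esub> x) ` K"
    then obtain x where x: "x \<in> K" "u = a \<odot>\<^bsub>M\<^esub> x" by blast
    have xK: "const_poly c \<odot>\<^bsub>M\<^esub> x \<in> K"
      using K x const_poly_in_diff_ring unfolding submodule_iff[OF module_M] by blast
    have xc: "x \<in> carrier M" using x Kc by auto
    have u: "const_poly c \<odot>\<^bsub>M\<^esub> u = a \<odot>\<^bsub>M\<^esub> (const_poly c \<odot>\<^bsub>M\<^esub> x)"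
      using smult_const_commute[OF a xc] x by simp
    show "const_poly c \<odot>\<^bsub>M\<^esub> u \<in> (\<lambda>x. a \<odot>\<^bsub>M\<^esub> x) ` K" unfolding u using xK by blast
    show "h (const_poly c \<odot>\<^bsub>M\<^esub> u) = c * h u"
      unfolding u using h x xK dual_const[OF insert.prems(3) xc] by simp
  qed blast
  let ?ag = "a \<odot>\<^bsub>dual M\<^esub> g"
  have ag: "?ag \<in> H" "?ag \<in> carrier (dual M)"
    using insert.prems(2) g(1) dual_closed(3)[OF a] by auto
  have "f \<ominus>\<^bsub>dual M\<^esub> ?ag \<in> H"
  proof (rule insert.IH[OF A])
    show "f \<ominus>\<^bsub>dual M\<^esub> ?ag \<in> carrier (dual M)" using insert.prems(3) ag by simp
    fix x assume x: "x \<in> carrier M" "\<And>b. b \<in> A \<Longrightarrow> b \<odot>\<^bsub>M\<^esub> x = \<zero>\<^bsub>M\<^esub>"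
    then have "x \<in> K" by (auto simp: K_def)
    then have "?ag x = f x" using g(2) h x(1) by (simp add: dual_ops)
    \<comment> \<open>The difference is evaluated by adding ?ag back, since \<open>dual_ops\<close>
      evaluates sums.\<close>
    moreover have "(f \<ominus>\<^bsub>dual M\<^esub> ?ag \<oplus>\<^bsub>dual M\<^esub> ?ag) x = f x"
      using insert.prems(3) ag by (simp add: a_minus_def D.M.a_assoc D.M.l_neg)
    ultimately show "(f \<ominus>\<^bsub>dual M\<^esub> ?ag) x = 0" using x(1) by (simp add: dual_ops)
  qed (use insert.prems in auto)
  then have "f \<ominus>\<^bsub>dual M\<^esub> ?ag \<oplus>\<^bsub>dual M\<^esub> ?ag \<in> H"
    using ag assms(3) unfolding submodule_iff[OF module_dual] by blast
  then show ?case using insert.prems(3) ag by (simp add: a_minus_def D.M.a_assoc D.M.l_neg)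
qed

end

section \<open>Exactness of dualization\<close>

lemma dual_map_closed:
  fixes M :: "('k::field mpoly, 'a, 'y) module_scheme"
  assumes "module (diff_ring n) M" "module (diff_ring n) N" "h \<in> mod_hom (diff_ring n) M N"
  shows "dual_map M h \<in> mod_hom (diff_ring n) (dual N) (dual M)"
proof (rule mod_homI)
  interpret M: module "diff_ring n" M by fact
  note hom = mod_homD[OF assms(3)]
  show closed: "dual_map M h f \<in> carrier (dual M)" if "f \<in> carrier (dual N)" for f
    unfolding dual_map_def using that hom
    by (intro dualI[OF assms(1)]) (simp_all add: const_poly_in_diff_ring dual_add[OF assms(2)] dual_const[OF assms(2)])
  note N = dual_closed[OF assms(2)] and MD = dual_closed[OF assms(1)]
  show "dual_map M h (f \<oplus>\<^bsub>dual N\<^esub> g) = dual_map M h f \<oplus>\<^bsub>dual M\<^esub> dual_map M h g"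
    if "f \<in> carrier (dual N)" "g \<in> carrier (dual N)" for f g
    using that hom by (intro dual_eqI[OF assms(1)] closed MD N)
      (simp_all add: dual_ops[OF assms(1)] dual_ops[OF assms(2)] dual_map_def)
  show "dual_map M h (p \<odot>\<^bsub>dual N\<^esub> f) = p \<odot>\<^bsub>dual M\<^esub> dual_map M h f"
    if "p \<in> carrier (diff_ring n)" "f \<in> carrier (dual N)" for p f
    using that hom by (intro dual_eqI[OF assms(1)] closed MD N)
      (simp_all add: dual_ops[OF assms(1)] dual_ops[OF assms(2)] dual_map_def)
qed

lemma dual_map_eq_zero_iff:
  "dual_map M h f = \<zero>\<^bsub>dual M\<^esub> \<longleftrightarrow> (\<forall>x\<in>carrier M. f (h x) = 0)"
  by (auto simp: dual_map_def dual_def restrict_def fun_eq_iff)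

text \<open>Injectivity and exactness in the middle are formal consequences of the surjectivity of
  \<open>\<pi>\<close> and of its kernel. Surjectivity of restriction to A is the point where
  functionals have to be extended.\<close>

lemma short_exact_dual:
  assumes "short_exact (diff_ring n) A i B \<pi> C"
  shows "short_exact (diff_ring n) (dual C) (dual_map B \<pi>) (dual B) (dual_map A i) (dual A)"
proof -
  from assms have A: "module (diff_ring n) A" and B: "module (diff_ring n) B"
    and C: "module (diff_ring n) C"
    and i: "i \<in> mod_hom (diff_ring n) A B" and \<pi>: "\<pi> \<in> mod_hom (diff_ring n) B C"
    and inj: "inj_on i (carrier A)"
    and ker: "i ` carrier A = {y \<in> carrier B. \<pi> y = \<zero>\<^bsub>C\<^esub>}" and surj: "\<pi> ` carrier B = carrier C"
    by (simp_all add: short_exact_def)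
  interpret A: module "diff_ring n" A by fact
  interpret B: module "diff_ring n" B by fact
  interpret C: module "diff_ring n" C by fact
  note \<pi>_hom = mod_homD[OF \<pi>] and i_hom = mod_homD[OF i]
  note \<pi>' = dual_map_closed[OF B C \<pi>] and i' = dual_map_closed[OF A B i]
  have "inj_on (dual_map B \<pi>) (carrier (dual C))"
  proof (rule mod_hom_inj_on[OF module_dual[OF C] module_dual[OF B] \<pi>'])
    fix f assume f: "f \<in> carrier (dual C)" "dual_map B \<pi> f = \<zero>\<^bsub>dual B\<^esub>"
    then have "f (\<pi> y) = 0" if "y \<in> carrier B" for y
      using that f(2) dual_map_eq_zero_iff[of B \<pi> f] by simp
    then have "f z = 0" if "z \<in> carrier C" for z
      using that unfolding surj[symmetric] by blast
    then show "f = \<zero>\<^bsub>dual C\<^esub>"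
      using f(1) by (intro dual_eqI[OF C] dual_closed[OF C]) (auto simp: dual_ops[OF C])
  qed
  moreover have "dual_map B \<pi> ` carrier (dual C) = {f \<in> carrier (dual B). dual_map A i f = \<zero>\<^bsub>dual A\<^esub>}"
  proof (intro equalityI subsetI)
    fix f assume "f \<in> dual_map B \<pi> ` carrier (dual C)"
    then obtain g where g: "g \<in> carrier (dual C)" "f = dual_map B \<pi> g" by blast
    have f: "f \<in> carrier (dual B)" using g mod_homD(1)[OF \<pi>'] by simp
    have "f (i x) = 0" if "x \<in> carrier A" for x
    proof -
      have "i x \<in> carrier B" "\<pi> (i x) = \<zero>\<^bsub>C\<^esub>" using ker that by auto
      then show ?thesis using g dual_zero[OF C] by (simp add: dual_map_def)
    qed
    then show "f \<in> {f \<in> carrier (dual B). dual_map A i f = \<zero>\<^bsub>dual A\<^esub>}"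
      using f dual_map_eq_zero_iff[of A i f] by simp
  next
    fix f assume "f \<in> {f \<in> carrier (dual B). dual_map A i f = \<zero>\<^bsub>dual A\<^esub>}"
    then have f: "f \<in> carrier (dual B)" and f0: "\<And>x. x \<in> carrier A \<Longrightarrow> f (i x) = 0"
      using dual_map_eq_zero_iff[of A i f] by auto
    define g where "g z = f (inv_into (carrier B) \<pi> z)" for z
    \<comment> \<open>Two preimages under \<open>\<pi>\<close> differ by an element of the image of
      \<open>i\<close>, on which \<open>f\<close> vanishes.\<close>
    have g: "g (\<pi> y) = f y" if y: "y \<in> carrier B" for y
    proof -
      let ?y = "inv_into (carrier B) \<pi> (\<pi> y)"
      have y': "?y \<in> carrier B" "\<pi> ?y = \<pi> y"
        using y by (auto intro: inv_into_into f_inv_into_f)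
      have "\<pi> (?y \<ominus>\<^bsub>B\<^esub> y) = \<zero>\<^bsub>C\<^esub>"
        using y y' \<pi>_hom by (simp add: mod_hom_minus[OF B C \<pi>] C.M.minus_eq_zero_iff)
      then have "?y \<ominus>\<^bsub>B\<^esub> y \<in> i ` carrier A" unfolding ker using y y'(1) by simp
      then have "f (?y \<ominus>\<^bsub>B\<^esub> y) = 0" using f0 by auto
      then show ?thesis using dual_minus[OF B f y'(1) y] by (simp add: g_def)
    qed
    have "(\<lambda>z\<in>carrier C. g z) \<in> carrier (dual C)"
    proof (rule dualI[OF C])
      fix u v assume "u \<in> carrier C" "v \<in> carrier C"
      then obtain x y where xy: "x \<in> carrier B" "y \<in> carrier B" "u = \<pi> x" "v = \<pi> y"
        using surj by (metis imageE)
      then show "g (u \<oplus>\<^bsub>C\<^esub> v) = g u + g v"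
        using g dual_add[OF B f] \<pi>_hom(2)[of x y] B.M.a_closed by metis
    next
      fix c u assume "u \<in> carrier C"
      then obtain x where x: "x \<in> carrier B" "u = \<pi> x" using surj by (metis imageE)
      then show "g (const_poly c \<odot>\<^bsub>C\<^esub> u) = c * g u"
        using g dual_const[OF B f] \<pi>_hom(3)[OF const_poly_in_diff_ring, of x c]
          smult_const_closed[OF B] by metis
    qed
    moreover have "f = dual_map B \<pi> (\<lambda>z\<in>carrier C. g z)"
      using calculation f g \<pi>_hom(1) by (intro dual_eqI[OF B] mod_homD(1)[OF \<pi>'])
        (auto simp: dual_map_def)
    ultimately show "f \<in> dual_map B \<pi> ` carrier (dual C)" by blast
  qed
  moreover have "dual_map A i ` carrier (dual B) = carrier (dual A)"
  proof (intro equalityI subsetI)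
    show "f \<in> carrier (dual A)" if "f \<in> dual_map A i ` carrier (dual B)" for f
      using that mod_homD(1)[OF i'] by blast
    fix g assume g: "g \<in> carrier (dual A)"
    \<comment> \<open>The functional on A is transported to the image of \<open>i\<close>, a
      subspace of B, and is extended from there.\<close>
    define h where "h y = g (inv_into (carrier A) i y)" for y
    have h: "h (i x) = g x" if "x \<in> carrier A" for x
      using that inj by (simp add: h_def)
    have W: "submodule (i ` carrier A) (diff_ring n) B" by (rule submodule_image[OF A B i])
    note W' = W[unfolded submodule_iff[OF B]]
    obtain f where f: "f \<in> carrier (dual B)" "\<And>y. y \<in> i ` carrier A \<Longrightarrow> f y = h y"
    proof (rule dual_extension[OF B, of "i ` carrier A" h])
      show "i ` carrier A \<subseteq> carrier B" "\<zero>\<^bsub>B\<^esub> \<in> i ` carrier A" using W' by blast+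
    next
      fix u v assume uv: "u \<in> i ` carrier A" "v \<in> i ` carrier A"
      then show "u \<oplus>\<^bsub>B\<^esub> v \<in> i ` carrier A" using W' by blast
      from uv obtain x y where "x \<in> carrier A" "y \<in> carrier A" "u = i x" "v = i y" by blast
      then show "h (u \<oplus>\<^bsub>B\<^esub> v) = h u + h v"
        using h dual_add[OF A g] i_hom(2)[of x y] A.M.a_closed by metis
    next
      fix c u assume u: "u \<in> i ` carrier A"
      then show "const_poly c \<odot>\<^bsub>B\<^esub> u \<in> i ` carrier A"
        using W' const_poly_in_diff_ring by blast
      from u obtain x where "x \<in> carrier A" "u = i x" by blast
      then show "h (const_poly c \<odot>\<^bsub>B\<^esub> u) = c * h u"
        using h dual_const[OF A g] i_hom(3)[OF const_poly_in_diff_ring, of x c]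
          smult_const_closed[OF A] by metis
    qed blast
    then have "g = dual_map A i f"
      using g h by (intro dual_eqI[OF A] mod_homD(1)[OF i']) (auto simp: dual_map_def)
    then show "g \<in> dual_map A i ` carrier (dual B)" using f(1) by blast
  qed
  ultimately show ?thesis
    unfolding short_exact_def using \<pi>' i' module_dual[OF A] module_dual[OF B] module_dual[OF C]
    by (intro conjI)
qed

section \<open>Maximality of the associated primes\<close>

lemma (in cring) exists_maximalideal:
  assumes "ideal I R" "I \<noteq> carrier R"
  obtains J where "maximalideal J R" "I \<subseteq> J"
proof -
  \<comment> \<open>Properness is expressed by the absence of the unit, a condition that survives
    unions of chains.\<close>
  define \<E> where "\<E> = {J. ideal J R \<and> I \<subseteq> J \<and> \<one> \<notin> J}"
  have "\<one> \<notin> I" using assms ideal.one_imp_carrier by blast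
  have "\<exists>J\<in>\<E>. \<forall>K\<in>\<E>. J \<subseteq> K \<longrightarrow> K = J"
  proof (rule subset_Zorn_nonempty)
    show "\<E> \<noteq> {}" using assms(1) \<open>\<one> \<notin> I\<close> by (auto simp: \<E>_def)
    fix C assume C: "C \<noteq> {}" "subset.chain \<E> C"
    then have "subset.chain {I. ideal I R} C"
      unfolding subset_chain_def \<E>_def by blast
    then have "ideal (\<Union>C) R" using chain_Union_is_ideal[of C] C(1) by simp
    moreover have "\<forall>J\<in>C. I \<subseteq> J \<and> \<one> \<notin> J" using C(2) unfolding subset_chain_def \<E>_def by blast
    ultimately show "\<Union>C \<in> \<E>" using C(1) unfolding \<E>_def by blast
  qed
  then obtain J where J: "J \<in> \<E>" and max: "\<And>K. K \<in> \<E> \<Longrightarrow> J \<subseteq> K \<Longrightarrow> K = J" by blast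
  interpret J: ideal J R using J by (simp add: \<E>_def)
  have "maximalideal J R"
  proof (rule maximalidealI)
    show "carrier R \<noteq> J" using J by (auto simp: \<E>_def)
    fix K assume K: "ideal K R" "J \<subseteq> K" "K \<subseteq> carrier R"
    show "K = J \<or> K = carrier R"
      using max[of K] J K ideal.one_imp_carrier[OF K(1)] by (auto simp: \<E>_def)
  qed (rule J.is_ideal)
  then show thesis using that J by (auto simp: \<E>_def)
qed

text \<open>If the zero ideal were not maximal, it would be a prime strictly contained in a maximal
  ideal, giving a chain of length one.\<close>

lemma (in domain) field_if_krull_dim_zero:
  assumes "krull_dim R = 0" shows "field R"
proof (rule ccontr)
  assume "\<not> field R"
  then have "\<not> maximalideal {\<zero>} R" using zeromaximalideal_fieldI by blast
  have "{\<zero>} \<noteq> carrier R" using carrier_one_not_zero one_not_zero by auto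
  then obtain J where J: "maximalideal J R" "{\<zero>} \<subseteq> J"
    by (rule exists_maximalideal[OF zeroideal])
  have J_prime: "primeideal J R" by (rule maximalideal_prime[OF J(1)])
  have "{\<zero>} \<subset> J" using J \<open>\<not> maximalideal {\<zero>} R\<close> by auto
  define P where "P i = (if i = 0 then {\<zero>} else J)" for i :: nat
  have "(\<forall>i\<le>1. primeideal (P i) R) \<and> (\<forall>i<1. P i \<subset> P (Suc i))"
    using J_prime zeroprimeideal \<open>{\<zero>} \<subset> J\<close> by (auto simp: P_def)
  then have "ereal (real 1) \<le> krull_dim R"
    unfolding krull_dim_def by (intro Sup_upper) blast
  then show False using assms by (simp add: one_ereal_def zero_ereal_def)
qed

text \<open>An element a of a larger ideal J outside I is invertible modulo I, so 1 - a b lies in I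
  and hence in J for some b; since a b also lies in J, so does 1.\<close>

lemma maximalideal_if_quotient_field:
  assumes "cring R" "ideal I R" "field (R Quot I)"
  shows "maximalideal I R"
proof -
  interpret cring R by fact
  interpret I: ideal I R by fact
  interpret Q: field "R Quot I" by fact
  have Q: "\<one>\<^bsub>R Quot I\<^esub> = I +>\<^bsub>R\<^esub> \<one>\<^bsub>R\<^esub>" "\<zero>\<^bsub>R Quot I\<^esub> = I"
    "carrier (R Quot I) = (\<lambda>a. I +>\<^bsub>R\<^esub> a) ` carrier R"
    by (auto simp: FactRing_def A_RCOSETS_def')
  show ?thesis
  proof (rule maximalidealI[OF assms(2)])
    show "carrier R \<noteq> I"
    proof
      assume "carrier R = I"
      then have "I +>\<^bsub>R\<^esub> \<one>\<^bsub>R\<^esub> = I" by (intro a_rcos_zero[OF assms(2)]) auto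
      then show False using Q.one_not_zero Q by simp
    qed
    fix J assume J: "ideal J R" "I \<subseteq> J" "J \<subseteq> carrier R"
    interpret J: ideal J R by fact
    have "J = carrier R" if "J \<noteq> I"
    proof -
      have "I \<subset> J" using J(2) that by simp
      from psubset_imp_ex_mem[OF this] obtain a where "a \<in> J - I" ..
      then have a: "a \<in> J" "a \<notin> I" by simp_all
      have ac: "a \<in> carrier R" using a(1) J.Icarr by simp
      have "I +>\<^bsub>R\<^esub> a \<noteq> I" using I.rcos_const_imp_mem[OF ac] a(2) by metis
      moreover have aQ: "I +>\<^bsub>R\<^esub> a \<in> carrier (R Quot I)" unfolding Q(3) using ac by (rule imageI)
      ultimately have "I +>\<^bsub>R\<^esub> a \<in> Units (R Quot I)" unfolding Q.field_Units Q(2) by simp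
      then have "\<exists>B\<in>carrier (R Quot I). (I +>\<^bsub>R\<^esub> a) \<otimes>\<^bsub>R Quot I\<^esub> B = \<one>\<^bsub>R Quot I\<^esub>"
        by (rule Q.Units_r_inv_ex)
      then obtain b where b: "b \<in> carrier R"
        "(I +>\<^bsub>R\<^esub> a) \<otimes>\<^bsub>R Quot I\<^esub> (I +>\<^bsub>R\<^esub> b) = \<one>\<^bsub>R Quot I\<^esub>"
        unfolding Q(3) by (elim bexE imageE) simp
      have "I +>\<^bsub>R\<^esub> (a \<otimes>\<^bsub>R\<^esub> b) = (I +>\<^bsub>R\<^esub> a) \<otimes>\<^bsub>R Quot I\<^esub> (I +>\<^bsub>R\<^esub> b)"
        using I.rcoset_mult_add[OF ac b(1)] by (simp add: FactRing_def)
      then have "I +>\<^bsub>R\<^esub> \<one>\<^bsub>R\<^esub> = I +>\<^bsub>R\<^esub> (a \<otimes>\<^bsub>R\<^esub> b)" by (simp only: b(2) Q(1))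
      then have "\<one>\<^bsub>R\<^esub> \<ominus>\<^bsub>R\<^esub> a \<otimes>\<^bsub>R\<^esub> b \<in> I"
        using quotient_eq_iff_same_a_r_cos[OF assms(2) one_closed m_closed[OF ac b(1)]] by simp
      then have "\<one>\<^bsub>R\<^esub> \<ominus>\<^bsub>R\<^esub> a \<otimes>\<^bsub>R\<^esub> b \<in> J" using J(2) by (rule rev_subsetD)
      moreover have ab: "a \<otimes>\<^bsub>R\<^esub> b \<in> J" using J.I_r_closed a(1) b(1) by simp
      ultimately have "\<one>\<^bsub>R\<^esub> \<ominus>\<^bsub>R\<^esub> a \<otimes>\<^bsub>R\<^esub> b \<oplus>\<^bsub>R\<^esub> a \<otimes>\<^bsub>R\<^esub> b \<in> J" by (rule J.a_closed)
      then have "\<one>\<^bsub>R\<^esub> \<in> J" using ac b(1) by (simp add: a_minus_def a_assoc l_neg)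
      then show ?thesis by (rule J.one_imp_carrier)
    qed
    then show "J = I \<or> J = carrier R" by metis
  qed
qed

text \<open>An associated prime is the annihilator of an element x, and by commutativity also of the
  cyclic module generated by x. Purity at x then says that the Krull dimension of the quotient is
  zero.\<close>

lemma n_pure_associated_prime_maximal:
  fixes M :: "('k::field mpoly, 'a, 'y) module_scheme"
  assumes "n_pure n M" "\<mm> \<in> associated_primes (diff_ring n) M"
  shows "maximalideal \<mm> (diff_ring n)"
proof -
  let ?R = "diff_ring n :: 'k mpoly ring"
  from assms(1) have "module ?R M" by (simp add: n_pure_def)
  then interpret M: module ?R M .
  from assms(2) obtain x where prime: "primeideal \<mm> ?R" and x: "x \<in> carrier M"
    and \<mm>: "\<mm> = {a \<in> carrier ?R. a \<odot>\<^bsub>M\<^esub> x = \<zero>\<^bsub>M\<^esub>}"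
    by (auto simp: associated_primes_def)
  interpret primeideal \<mm> ?R by fact
  \<comment> \<open>Purity speaks about nonzero elements; x = 0 would make the prime ideal the whole
    ring.\<close>
  have "x \<noteq> \<zero>\<^bsub>M\<^esub>"
  proof
    assume "x = \<zero>\<^bsub>M\<^esub>"
    then have "\<mm> = carrier ?R" unfolding \<mm> by auto
    then show False using I_notcarr by simp
  qed
  then have "cd n (cyclic_submodule ?R M x) = ereal (real n)"
    using assms(1) x by (simp add: n_pure_def)
  moreover have "annihilator ?R (cyclic_submodule ?R M x) = \<mm>"
  proof -
    have "(\<forall>b\<in>carrier ?R. a \<odot>\<^bsub>M\<^esub> (b \<odot>\<^bsub>M\<^esub> x) = \<zero>\<^bsub>M\<^esub>) \<longleftrightarrow> a \<odot>\<^bsub>M\<^esub> x = \<zero>\<^bsub>M\<^esub>"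
      if a: "a \<in> carrier ?R" for a
    proof
      assume "\<forall>b\<in>carrier ?R. a \<odot>\<^bsub>M\<^esub> (b \<odot>\<^bsub>M\<^esub> x) = \<zero>\<^bsub>M\<^esub>"
      then have "a \<odot>\<^bsub>M\<^esub> (\<one>\<^bsub>?R\<^esub> \<odot>\<^bsub>M\<^esub> x) = \<zero>\<^bsub>M\<^esub>" by blast
      then show "a \<odot>\<^bsub>M\<^esub> x = \<zero>\<^bsub>M\<^esub>" using x by simp
    next
      assume ax: "a \<odot>\<^bsub>M\<^esub> x = \<zero>\<^bsub>M\<^esub>"
      show "\<forall>b\<in>carrier ?R. a \<odot>\<^bsub>M\<^esub> (b \<odot>\<^bsub>M\<^esub> x) = \<zero>\<^bsub>M\<^esub>"
      proof
        fix b assume b: "b \<in> carrier ?R"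
        have "a \<odot>\<^bsub>M\<^esub> (b \<odot>\<^bsub>M\<^esub> x) = b \<odot>\<^bsub>M\<^esub> (a \<odot>\<^bsub>M\<^esub> x)"
          using M.smult_assoc1[OF a b x] M.smult_assoc1[OF b a x] M.R.m_comm[OF a b] by simp
        then show "a \<odot>\<^bsub>M\<^esub> (b \<odot>\<^bsub>M\<^esub> x) = \<zero>\<^bsub>M\<^esub>" using ax b by simp
      qed
    qed
    then show ?thesis unfolding \<mm> annihilator_def cyclic_submodule_def by auto
  qed
  \<comment> \<open>In the extended reals n - d = n forces d = 0: as n is finite, both infinite
    values of d are excluded.\<close>
  ultimately have "krull_dim (?R Quot \<mm>) = 0"
    unfolding cd_def module_dim_def
    by (cases "krull_dim (?R Quot \<mm>)") (auto simp: zero_ereal_def)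
  then have "field (?R Quot \<mm>)"
    by (rule domain.field_if_krull_dim_zero[OF quotient_is_domain])
  then show ?thesis
    by (intro maximalideal_if_quotient_field cring_diff_ring is_ideal)
qed

section \<open>The socle\<close>

lemma submodule_killed_by_ideal:
  assumes "module R M" "ideal I R"
  shows "submodule {x \<in> carrier M. \<forall>a\<in>I. a \<odot>\<^bsub>M\<^esub> x = \<zero>\<^bsub>M\<^esub>} R M"
proof -
  interpret M: module R M by fact
  interpret I: ideal I R by fact
  have "a \<odot>\<^bsub>M\<^esub> (p \<odot>\<^bsub>M\<^esub> x) = \<zero>\<^bsub>M\<^esub>"
    if "a \<in> I" "p \<in> carrier R" "x \<in> carrier M" "\<forall>a\<in>I. a \<odot>\<^bsub>M\<^esub> x = \<zero>\<^bsub>M\<^esub>" for a p x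
    using that M.smult_assoc1[of a p x] I.I_r_closed[of a p] I.Icarr by simp
  then show ?thesis
    unfolding submodule_iff[OF assms(1)] using I.Icarr by (auto simp: M.smult_r_distr)
qed

text \<open>The annihilator of x contains \<open>\<mm>\<close> and misses the unit, so it equals
  \<open>\<mm>\<close>, and a |-> a x induces an isomorphism from R/\<mm> onto the cyclic
  submodule.\<close>

lemma cyclic_submodule_killed_by_maximalideal:
  assumes "module R M" "maximalideal \<mm> R" "x \<in> carrier M" "x \<noteq> \<zero>\<^bsub>M\<^esub>"
    and kill: "\<And>a. a \<in> \<mm> \<Longrightarrow> a \<odot>\<^bsub>M\<^esub> x = \<zero>\<^bsub>M\<^esub>"
  defines "S \<equiv> (\<lambda>a. a \<odot>\<^bsub>M\<^esub> x) ` carrier R"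
  shows "submodule S R M" "simple_module R (M\<lparr>carrier := S\<rparr>)"
    "mod_iso R (M\<lparr>carrier := S\<rparr>) (quot_module (ring_as_module R) \<mm>) \<noteq> {}"
proof -
  interpret M: module R M by fact
  interpret \<mm>: maximalideal \<mm> R by fact
  let ?D = "ring_as_module R"
  have D: "module R ?D" by (rule module_ring_as_module[OF M.R.is_cring])
  have \<mm>D: "submodule \<mm> R ?D" by (rule submodule_ideal[OF M.R.is_cring \<mm>.is_ideal])
  have D_simps: "carrier ?D = carrier R" "add ?D = add R" "module.smult ?D = monoid.mult R"
    by (simp_all add: ring_as_module_def)
  have hom: "(\<lambda>a. a \<odot>\<^bsub>M\<^esub> x) \<in> mod_hom R ?D M"
    by (rule mod_hom_smult_right[OF assms(1,3)])
  show S: "submodule S R M"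
    using submodule_image[OF D assms(1) hom] by (simp add: S_def D_simps)
  let ?S = "M\<lparr>carrier := S\<rparr>"
  have modS: "module R ?S" by (rule submodule.submodule_is_module[OF S assms(1)])
  have ann: "{a \<in> carrier R. a \<odot>\<^bsub>M\<^esub> x = \<zero>\<^bsub>M\<^esub>} = \<mm>"
  proof -
    have "ideal {a \<in> carrier R. a \<odot>\<^bsub>M\<^esub> x = \<zero>\<^bsub>M\<^esub>} R"
      by (rule ideal_annihilator[OF assms(1,3)])
    then have "{a \<in> carrier R. a \<odot>\<^bsub>M\<^esub> x = \<zero>\<^bsub>M\<^esub>} = \<mm> \<or>
      {a \<in> carrier R. a \<odot>\<^bsub>M\<^esub> x = \<zero>\<^bsub>M\<^esub>} = carrier R"
      using kill \<mm>.Icarr by (intro \<mm>.I_maximal) auto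
    moreover have "\<one>\<^bsub>R\<^esub> \<odot>\<^bsub>M\<^esub> x \<noteq> \<zero>\<^bsub>M\<^esub>" using assms(3,4) by simp
    ultimately show ?thesis using M.R.one_closed by blast
  qed
  have eq_iff: "a \<odot>\<^bsub>M\<^esub> x = b \<odot>\<^bsub>M\<^esub> x \<longleftrightarrow> a \<ominus>\<^bsub>R\<^esub> b \<in> \<mm>"
    if "a \<in> carrier R" "b \<in> carrier R" for a b
  proof -
    have "a \<ominus>\<^bsub>R\<^esub> b \<in> \<mm> \<longleftrightarrow> (a \<ominus>\<^bsub>R\<^esub> b) \<odot>\<^bsub>M\<^esub> x = \<zero>\<^bsub>M\<^esub>"
      using that by (subst ann[symmetric]) simp
    also have "(a \<ominus>\<^bsub>R\<^esub> b) \<odot>\<^bsub>M\<^esub> x = a \<odot>\<^bsub>M\<^esub> x \<ominus>\<^bsub>M\<^esub> b \<odot>\<^bsub>M\<^esub> x"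
      using that assms(3) by (simp add: a_minus_def M.smult_l_distr M.smult_l_minus)
    finally show ?thesis using that assms(3) by (simp add: M.M.minus_eq_zero_iff)
  qed
  show "simple_module R ?S"
    unfolding simple_module_def
  proof (intro conjI allI impI modS)
    have "x \<in> S" unfolding S_def using assms(3) by (intro image_eqI[of _ _ "\<one>\<^bsub>R\<^esub>"]) auto
    then show "carrier ?S \<noteq> {\<zero>\<^bsub>?S\<^esub>}" using assms(4) by auto
    fix H assume "submodule H R ?S"
    then have H: "H \<subseteq> S" "\<zero>\<^bsub>M\<^esub> \<in> H" "\<And>a y. a \<in> carrier R \<Longrightarrow> y \<in> H \<Longrightarrow> a \<odot>\<^bsub>M\<^esub> y \<in> H"
      unfolding submodule_iff[OF modS] by auto
    have "H = S" if "H \<noteq> {\<zero>\<^bsub>M\<^esub>}"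
    proof -
      have "{\<zero>\<^bsub>M\<^esub>} \<subset> H" using H(2) that by auto
      from psubset_imp_ex_mem[OF this] obtain y where "y \<in> H - {\<zero>\<^bsub>M\<^esub>}" ..
      then have y: "y \<in> H" "y \<noteq> \<zero>\<^bsub>M\<^esub>" by simp_all
      have "y \<in> S" using H(1) y(1) by (rule subsetD)
      then obtain a where a: "a \<in> carrier R" "y = a \<odot>\<^bsub>M\<^esub> x"
        unfolding S_def by (rule imageE) simp
      \<comment> \<open>The colon ideal (H : x) contains \<open>\<mm>\<close> and also the element a
        outside it, so maximality makes it the whole ring.\<close>
      have "{b \<in> carrier R. b \<odot>\<^bsub>M\<^esub> x \<in> H} = carrier R"
      proof -
        have "submodule H R M"
          using \<open>submodule H R ?S\<close> S unfolding submodule_iff[OF modS] submodule_iff[OF assms(1)]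
          by auto
        then have "ideal {b \<in> carrier R. b \<odot>\<^bsub>M\<^esub> x \<in> H} R"
          by (rule ideal_transporter[OF assms(1,3)])
        moreover have "\<mm> \<subseteq> {b \<in> carrier R. b \<odot>\<^bsub>M\<^esub> x \<in> H}"
          using kill H(2) \<mm>.Icarr by auto
        moreover have "a \<in> {b \<in> carrier R. b \<odot>\<^bsub>M\<^esub> x \<in> H}" "a \<notin> \<mm>"
          using a y kill by auto
        ultimately show ?thesis using \<mm>.I_maximal[of "{b \<in> carrier R. b \<odot>\<^bsub>M\<^esub> x \<in> H}"] by auto
      qed
      then have "S \<subseteq> H" unfolding S_def by auto
      with H(1) show ?thesis by (rule subset_antisym)
    qed
    then show "H = {\<zero>\<^bsub>?S\<^esub>} \<or> H = carrier ?S" by auto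
  qed
  \<comment> \<open>\<open>h\<close> inverts the map a + \<mm> |-> a x; the chosen a is determined
    modulo \<open>\<mm>\<close>.\<close>
  define h where "h y = \<mm> +>\<^bsub>?D\<^esub> (SOME a. a \<in> carrier R \<and> a \<odot>\<^bsub>M\<^esub> x = y)" for y
  have h: "h (a \<odot>\<^bsub>M\<^esub> x) = \<mm> +>\<^bsub>?D\<^esub> a" if "a \<in> carrier R" for a
  proof -
    define b where "b = (SOME b. b \<in> carrier R \<and> b \<odot>\<^bsub>M\<^esub> x = a \<odot>\<^bsub>M\<^esub> x)"
    have "b \<in> carrier R \<and> b \<odot>\<^bsub>M\<^esub> x = a \<odot>\<^bsub>M\<^esub> x"
      unfolding b_def by (rule someI[of _ a]) (simp add: that)
    then have "b \<ominus>\<^bsub>R\<^esub> a \<in> \<mm>" "b \<in> carrier R" using eq_iff that by auto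
    then have "\<mm> +>\<^bsub>?D\<^esub> b = \<mm> +>\<^bsub>?D\<^esub> a"
      using M.R.quotient_eq_iff_same_a_r_cos[OF \<mm>.is_ideal, of b a] that
      by (simp add: a_r_coset_def' D_simps)
    then show ?thesis by (simp add: h_def b_def)
  qed
  have coset_eq: "\<mm> +>\<^bsub>?D\<^esub> a = \<mm> +>\<^bsub>?D\<^esub> b \<longleftrightarrow> a \<odot>\<^bsub>M\<^esub> x = b \<odot>\<^bsub>M\<^esub> x"
    if "a \<in> carrier R" "b \<in> carrier R" for a b
    using M.R.quotient_eq_iff_same_a_r_cos[OF \<mm>.is_ideal, of a b] that eq_iff[OF that]
    by (simp add: a_r_coset_def' D_simps)
  have "h \<in> mod_iso R ?S (quot_module ?D \<mm>)"
    unfolding mod_iso_def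
  proof (intro CollectI conjI mod_homI)
    fix y z assume "y \<in> carrier ?S" "z \<in> carrier ?S"
    then obtain a b where ab: "a \<in> carrier R" "b \<in> carrier R" "y = a \<odot>\<^bsub>M\<^esub> x" "z = b \<odot>\<^bsub>M\<^esub> x"
      by (auto simp: S_def)
    then have "y \<oplus>\<^bsub>M\<^esub> z = (a \<oplus>\<^bsub>R\<^esub> b) \<odot>\<^bsub>M\<^esub> x" using assms(3) by (simp add: M.smult_l_distr)
    then have "h (y \<oplus>\<^bsub>M\<^esub> z) = \<mm> +>\<^bsub>?D\<^esub> (a \<oplus>\<^bsub>R\<^esub> b)" using h ab by simp
    then show "h (y \<oplus>\<^bsub>?S\<^esub> z) = h y \<oplus>\<^bsub>quot_module ?D \<mm>\<^esub> h z"
      using quot_module_add[OF D \<mm>D, of a b] ab h by (simp add: D_simps)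
  next
    fix r y assume r: "r \<in> carrier R" and "y \<in> carrier ?S"
    then obtain a where a: "a \<in> carrier R" "y = a \<odot>\<^bsub>M\<^esub> x" by (auto simp: S_def)
    then have "r \<odot>\<^bsub>M\<^esub> y = (r \<otimes>\<^bsub>R\<^esub> a) \<odot>\<^bsub>M\<^esub> x" using assms(3) r by (simp add: M.smult_assoc1)
    then have "h (r \<odot>\<^bsub>M\<^esub> y) = \<mm> +>\<^bsub>?D\<^esub> (r \<otimes>\<^bsub>R\<^esub> a)" using h a r by simp
    then show "h (r \<odot>\<^bsub>?S\<^esub> y) = r \<odot>\<^bsub>quot_module ?D \<mm>\<^esub> h y"
      using quot_module_smult[OF D \<mm>D, of r a] a r h by (simp add: D_simps)
  next
    show "bij_betw h (carrier ?S) (carrier (quot_module ?D \<mm>))"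
    proof (rule bij_betw_imageI)
      show "inj_on h (carrier ?S)"
        using h coset_eq by (auto simp: S_def intro!: inj_onI)
      show "h ` carrier ?S = carrier (quot_module ?D \<mm>)"
        using h by (auto simp: S_def quot_module_carrier D_simps image_image)
    qed
  qed (use h in \<open>auto simp: S_def quot_module_carrier D_simps\<close>)
  then show "mod_iso R ?S (quot_module ?D \<mm>) \<noteq> {}" by blast
qed

text \<open>A submodule isomorphic to R/\<mm> is killed by \<open>\<mm>\<close> because R/\<mm> is.
  Conversely, a nonzero element killed by \<open>\<mm>\<close> spans a copy of R/\<mm>, so it lies
  already in the union of these submodules.\<close>

lemma socle_at_carrier:
  assumes "module R M" "maximalideal \<mm> R"
  shows "carrier (socle_at R \<mm> M) = {x \<in> carrier M. \<forall>a\<in>\<mm>. a \<odot>\<^bsub>M\<^esub> x = \<zero>\<^bsub>M\<^esub>}"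
    (is "_ = ?K")
proof -
  interpret M: module R M by fact
  interpret \<mm>: maximalideal \<mm> R by fact
  let ?D = "ring_as_module R"
  let ?Q = "quot_module ?D \<mm>"
  have D: "module R ?D" by (rule module_ring_as_module[OF M.R.is_cring])
  have \<mm>D: "submodule \<mm> R ?D" by (rule submodule_ideal[OF M.R.is_cring \<mm>.is_ideal])
  have Q: "module R ?Q" by (rule module_quot_module[OF D \<mm>D])
  have K: "submodule ?K R M" by (rule submodule_killed_by_ideal[OF assms(1) \<mm>.is_ideal])
  let ?U = "\<Union>{S. submodule S R M \<and> simple_module R (M\<lparr>carrier := S\<rparr>) \<and>
    mod_iso R (M\<lparr>carrier := S\<rparr>) ?Q \<noteq> {}}"
  have "?U \<subseteq> ?K"
  proof safe
    fix x S h assume S: "submodule S R M" and x: "x \<in> S" and h: "h \<in> mod_iso R (M\<lparr>carrier := S\<rparr>) ?Q"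
    show "x \<in> carrier M" using M.submoduleE(1)[OF S] x by blast
    fix a assume a: "a \<in> \<mm>"
    let ?S = "M\<lparr>carrier := S\<rparr>"
    have modS: "module R ?S" by (rule submodule.submodule_is_module[OF S assms(1)])
    have hom: "h \<in> mod_hom R ?S ?Q" and inj: "inj_on h S"
      using h by (auto simp: mod_iso_def bij_betw_def)
    have ac: "a \<in> carrier R" using a \<mm>.Icarr by simp
    obtain b where b: "b \<in> carrier R" "h x = \<mm> +>\<^bsub>?D\<^esub> b"
      using mod_homD(1)[OF hom, of x] x by (auto simp: quot_module_carrier ring_as_module_def)
    have "h (a \<odot>\<^bsub>M\<^esub> x) = a \<odot>\<^bsub>?Q\<^esub> h x"
      using mod_homD(3)[OF hom ac, of x] x by simp
    also have "\<dots> = \<mm> +>\<^bsub>?D\<^esub> (a \<otimes>\<^bsub>R\<^esub> b)"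
      using quot_module_smult[OF D \<mm>D ac, of b] b by (simp add: ring_as_module_def)
    also have "\<dots> = \<mm>"
      using quot_module_coset_eq_self_iff[OF D \<mm>D, of "a \<otimes>\<^bsub>R\<^esub> b"] ac b \<mm>.I_r_closed[OF a b(1)]
      by (simp add: ring_as_module_def)
    \<comment> \<open>The coset \<open>\<mm>\<close> is the zero of the quotient, hence the image of
      zero, and injectivity of \<open>h\<close> on S applies.\<close>
    also have "\<dots> = h \<zero>\<^bsub>M\<^esub>"
      using mod_hom_zero[OF modS Q hom] by (simp add: quot_module_def)
    finally show "a \<odot>\<^bsub>M\<^esub> x = \<zero>\<^bsub>M\<^esub>"
      using S x ac unfolding submodule_iff[OF assms(1)] by (intro inj_onD[OF inj]) blast+
  qed
  then have "mod_span R M ?U \<subseteq> ?K" by (rule mod_span_minimal[OF K])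
  moreover have "?K \<subseteq> mod_span R M ?U"
  proof safe
    fix x assume x: "x \<in> carrier M" "\<forall>a\<in>\<mm>. a \<odot>\<^bsub>M\<^esub> x = \<zero>\<^bsub>M\<^esub>"
    show "x \<in> mod_span R M ?U"
    proof (cases "x = \<zero>\<^bsub>M\<^esub>")
      case True
      \<comment> \<open>Zero spans no simple submodule; it belongs to the span because the span is a
        submodule.\<close>
      have "?U \<subseteq> carrier M" using \<open>?U \<subseteq> ?K\<close> by blast
      from submodule_mod_span[OF assms(1) this] show ?thesis
        unfolding submodule_iff[OF assms(1)] True by blast
    next
      case False
      let ?S = "(\<lambda>a. a \<odot>\<^bsub>M\<^esub> x) ` carrier R"
      have "x \<in> ?S" using x(1) by (intro image_eqI[of _ _ "\<one>\<^bsub>R\<^esub>"]) auto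
      moreover have "?S \<subseteq> ?U"
        using cyclic_submodule_killed_by_maximalideal[OF assms x(1) False] x(2)
        by (intro Union_upper) blast
      ultimately show ?thesis using mod_span_superset[of ?U R M] by blast
    qed
  qed
  ultimately show ?thesis by (simp add: socle_at_def)
qed

section \<open>Functionals vanishing on the socle\<close>

text \<open>The annihilator of x is an ideal. This reduces being killed by an ideal to being killed
  by its generators.\<close>

lemma (in ring) killed_by_genideal:
  assumes "module R M" "A \<subseteq> carrier R" "x \<in> carrier M"
    and "\<And>a. a \<in> A \<Longrightarrow> a \<odot>\<^bsub>M\<^esub> x = \<zero>\<^bsub>M\<^esub>" and "b \<in> Idl A"
  shows "b \<odot>\<^bsub>M\<^esub> x = \<zero>\<^bsub>M\<^esub>"
proof -
  have "ideal {b \<in> carrier R. b \<odot>\<^bsub>M\<^esub> x = \<zero>\<^bsub>M\<^esub>} R"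
    by (rule ideal_annihilator[OF assms(1,3)])
  then have "Idl A \<subseteq> {b \<in> carrier R. b \<odot>\<^bsub>M\<^esub> x = \<zero>\<^bsub>M\<^esub>}"
    using assms(2,4) by (intro genideal_minimal) auto
  then show ?thesis using assms(5) by blast
qed

text \<open>The products of \<open>I\<close> with the dual span exactly the orthogonal complement of
  the elements killed by \<open>I\<close>. One inclusion is (a g)(x) = g(a x); the other is
  \<open>dual_vanishing_mem\<close> for a finite generating set of \<open>I\<close>.\<close>

lemma ideal_mult_dual_carrier:
  fixes M :: "('k::field mpoly, 'a, 'y) module_scheme"
  assumes M: "module (diff_ring n) M" and I: "ideal I (diff_ring n)"
  shows "carrier (ideal_mult_module (diff_ring n) I (dual M)) =
    {f \<in> carrier (dual M). \<forall>x\<in>carrier M. (\<forall>a\<in>I. a \<odot>\<^bsub>M\<^esub> x = \<zero>\<^bsub>M\<^esub>) \<longrightarrow> f x = 0}"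
    (is "_ = ?V")
proof -
  let ?R = "diff_ring n :: 'k mpoly ring"
  let ?gens = "{a \<odot>\<^bsub>dual M\<^esub> f | a f. a \<in> I \<and> f \<in> carrier (dual M)}"
  interpret noetherian_ring ?R by (rule noetherian_ring_diff_ring)
  interpret M: module ?R M by (rule M)
  interpret I: ideal I ?R by (rule I)
  have gens: "?gens \<subseteq> carrier (dual M)" using dual_closed(3)[OF M] I.Icarr by auto
  have "submodule ?V ?R (dual M)"
  proof -
    have "f (p \<odot>\<^bsub>M\<^esub> x) = 0"
      if p: "p \<in> carrier ?R" and f: "\<forall>x\<in>carrier M. (\<forall>a\<in>I. a \<odot>\<^bsub>M\<^esub> x = \<zero>\<^bsub>M\<^esub>) \<longrightarrow> f x = 0"
        and x: "x \<in> carrier M" "\<forall>a\<in>I. a \<odot>\<^bsub>M\<^esub> x = \<zero>\<^bsub>M\<^esub>" for p f x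
    proof -
      have "\<forall>a\<in>I. a \<odot>\<^bsub>M\<^esub> (p \<odot>\<^bsub>M\<^esub> x) = \<zero>\<^bsub>M\<^esub>"
        using submodule_killed_by_ideal[OF M I] p x unfolding submodule_iff[OF M] by blast
      then show ?thesis using f p x(1) by simp
    qed
    then show ?thesis
      unfolding submodule_iff[OF module_dual[OF M]]
      by (auto simp: dual_closed[OF M] dual_ops[OF M])
  qed
  then have "mod_span ?R (dual M) ?gens \<subseteq> ?V"
    using gens by (intro mod_span_minimal) (auto simp: dual_ops[OF M] dual_zero[OF M])
  moreover have "?V \<subseteq> mod_span ?R (dual M) ?gens"
  proof
    fix f assume f: "f \<in> ?V"
    \<comment> \<open>The induction in \<open>dual_vanishing_mem\<close> runs over a finite set,
      supplied here by the basis theorem.\<close>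
    obtain A where A: "A \<subseteq> carrier ?R" "finite A" "I = Idl\<^bsub>?R\<^esub> A"
      using finetely_gen[OF I] by blast
    show "f \<in> mod_span ?R (dual M) ?gens"
    proof (rule dual_vanishing_mem[OF M A(2,1)])
      show "submodule (mod_span ?R (dual M) ?gens) ?R (dual M)"
        by (rule submodule_mod_span[OF module_dual[OF M] gens])
      show "a \<odot>\<^bsub>dual M\<^esub> g \<in> mod_span ?R (dual M) ?gens"
        if "a \<in> A" "g \<in> carrier (dual M)" for a g
        using that genideal_self[OF A(1)] A(3) by (intro subsetD[OF mod_span_superset]) blast
      show "f \<in> carrier (dual M)" using f by simp
      show "f x = 0" if "x \<in> carrier M" "\<And>a. a \<in> A \<Longrightarrow> a \<odot>\<^bsub>M\<^esub> x = \<zero>\<^bsub>M\<^esub>" for x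
        using f that killed_by_genideal[OF M A(1)] A(3) by blast
    qed
  qed
  ultimately show ?thesis by (simp add: ideal_mult_module_def)
qed

text \<open>The quotient N is given by an arbitrary surjection \<open>\<pi>\<close> with kernel the
  socle, so the result is independent of a chosen model. The third conjunct is the left-hand
  isomorphism contained in the fourth.\<close>

theorem theorem5p2p2:
  fixes n :: nat
    and M :: "('k::field_char_0 mpoly, 'a) module"
    and N :: "('k mpoly, 'b) module"
    and \<mm> :: "'k mpoly set"
    and \<pi> :: "'a \<Rightarrow> 'b"
  assumes "n_pure n M"
    and "\<mm> \<in> associated_primes (diff_ring n) M"
    and "short_exact (diff_ring n) (socle_at (diff_ring n) \<mm> M) (\<lambda>x. x) M \<pi> N"
  shows "short_exact (diff_ring n)
           (dual N) (dual_map M \<pi>) (dual M)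
           (dual_map (socle_at (diff_ring n) \<mm> M) (\<lambda>x. x)) (top_at n \<mm> M)
    \<and> short_exact (diff_ring n)
           (ideal_mult_module (diff_ring n) \<mm> (dual M)) (\<lambda>f. f) (dual M)
           (residue_tensor_map n \<mm> (dual M))
           (tensor_module (diff_ring n) (residue_module n \<mm>) (dual M))
    \<and> mod_iso (diff_ring n) (dual N) (ideal_mult_module (diff_ring n) \<mm> (dual M)) \<noteq> {}
    \<and> sequences_isomorphic (diff_ring n)
           (dual N) (dual_map M \<pi>) (dual M)
           (dual_map (socle_at (diff_ring n) \<mm> M) (\<lambda>x. x)) (top_at n \<mm> M)
           (ideal_mult_module (diff_ring n) \<mm> (dual M)) (\<lambda>f. f) (dual M)
           (residue_tensor_map n \<mm> (dual M))
           (tensor_module (diff_ring n) (residue_module n \<mm>) (dual M))"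
proof -
  let ?R = "diff_ring n :: 'k mpoly ring" and ?S = "socle_at (diff_ring n) \<mm> M"
  have M: "module ?R M" using assms(1) by (simp add: n_pure_def)
  have S: "module ?R ?S" and incl: "(\<lambda>x. x) \<in> mod_hom ?R ?S M"
    using assms(3) by (simp_all add: short_exact_def)
  have max: "maximalideal \<mm> ?R" by (rule n_pure_associated_prime_maximal[OF assms(1,2)])
  then have ideal: "ideal \<mm> ?R" by (rule maximalideal.axioms(1))
  have dual_seq: "short_exact ?R (dual N) (dual_map M \<pi>) (dual M) (dual_map ?S (\<lambda>x. x)) (top_at n \<mm> M)"
    unfolding top_at_def by (rule short_exact_dual[OF assms(3)])
  have tensor_seq: "short_exact ?R (ideal_mult_module ?R \<mm> (dual M)) (\<lambda>f. f) (dual M)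
      (residue_tensor_map n \<mm> (dual M)) (tensor_module ?R (residue_module n \<mm>) (dual M))"
    unfolding residue_tensor_map_def by (rule short_exact_residue_tensor[OF module_dual[OF M] ideal])
  \<comment> \<open>Both injections have the same image in the dual of M, the functionals vanishing
    on the socle; this is the hypothesis of the comparison lemma.\<close>
  have "dual_map M \<pi> ` carrier (dual N) = {f \<in> carrier (dual M). dual_map ?S (\<lambda>x. x) f = \<zero>\<^bsub>dual ?S\<^esub>}"
    using dual_seq by (simp add: short_exact_def top_at_def)
  also have "\<dots> = {f \<in> carrier (dual M). \<forall>x\<in>carrier ?S. f x = 0}"
    by (simp only: dual_map_eq_zero_iff)
  also have "\<dots> = (\<lambda>f. f) ` carrier (ideal_mult_module ?R \<mm> (dual M))"
    unfolding ideal_mult_dual_carrier[OF M ideal] socle_at_carrier[OF M max] by auto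
  finally have iso: "sequences_isomorphic ?R (dual N) (dual_map M \<pi>) (dual M)
      (dual_map ?S (\<lambda>x. x)) (top_at n \<mm> M) (ideal_mult_module ?R \<mm> (dual M)) (\<lambda>f. f) (dual M)
      (residue_tensor_map n \<mm> (dual M)) (tensor_module ?R (residue_module n \<mm>) (dual M))"
    by (rule sequences_isomorphic_if_same_kernel[OF dual_seq tensor_seq])
  then have "mod_iso ?R (dual N) (ideal_mult_module ?R \<mm> (dual M)) \<noteq> {}"
    unfolding sequences_isomorphic_def by blast
  with dual_seq tensor_seq iso show ?thesis by blast
qed

end
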